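(* Consider an execution of the DRL transition system in which every actor eventually takes a snapshot after performing an Idle, Info, or Release event. Then every terminated actor is eventually part of a finalized set of snapshots.
   Context: DRL transition system. Refobs are triples $x: A\to B$ (owner $A$, target $B$, unique token $x$). Facts: $\mathrm{Created}(x)$, $\mathrm{Released}(x)$, $\mathrm{CreatedUsing}(x,y)$, $\mathrm{Activated}(x)$, $\mathrm{Unreleased}(x)$, $\mathrm{SentCount}(x,n)$, $\mathrm{RecvCount}(x,n)$. For a knowledge set $\Phi$, $\Phi\vdash\phi$ means derivability in first-order logic plus: absent any $\mathrm{SentCount}(x,n)$, $\Phi\vdash\mathrm{SentCount}(x,0)$; likewise $\mathrm{RecvCount}$; $\Phi\vdash\mathrm{Created}(x)\wedge\neg\mathrm{Released}(x)$ implies $\Phi\vdash\mathrm{Unreleased}(x)$; $\Phi\vdash\mathrm{CreatedUsing}(x,y)$ implies $\Phi\vdash\mathrm{Created}(y)$. Configurations $(\alpha,\mu,\rho,\chi)$: $\alpha$ maps internal actors to knowledge sets (busy or idle), $\mu$ maps actors to multisets of undelivered messages ($\mathrm{app}(x,R)$, $\mathrm{info}(y,z,B)$, $\mathrm{release}(x,n)$), $\rho\subseteq\mathrm{dom}(\alpha)$ receptionists, $\chi$ external actors. Initial configuration: one busy actor $A$ with $\{\mathrm{Activated}(x:A\to E),\mathrm{Created}(y:A\to A),\mathrm{Activated}(y:A\to A)\}$, no messages, $\rho=\emptyset$, $\chi=\{E\}$. Rules: Spawn (busy $A$ spawns fresh $B$ with fresh $x,y$: $A$ adds $\mathrm{Activated}(x:A\to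 B)$, $B$ starts busy with $\{\mathrm{Created}(x),\mathrm{Created}(y:B\to B),\mathrm{Activated}(y)\}$); Send (busy $A$ with $\Phi\vdash\mathrm{Activated}(x:A\to B)$ and $\Phi\vdash\mathrm{Activated}(y_i:A\to C_i)$, fresh $z_i$: increments send count of $x$, adds $\mathrm{CreatedUsing}(y_i,z_i)$, sends $\mathrm{app}(x,\{z_i:B\to C_i\})$ to $B$); Receive (idle $B$ consumes $\mathrm{app}(x,R)$, becomes busy, increments receive count of $x$, adds $\mathrm{Activated}(z)$ for $z\in R$); Idle (busy becomes idle); SendInfo (busy $A$ removes $\mathrm{CreatedUsing}(y:A\to C,z:B\to C)$, increments send count of $y$, sends $\mathrm{info}(y,z,B)$ to $C$); Info (idle $C$ consumes it, increments receive count of $y$, adds $\mathrm{Created}(z)$); SendRelease (busy $A$ with $\mathrm{Activated}(x:A\to B),\mathrm{SentCount}(x,n)$ and no $\mathrm{CreatedUsing}(x,\cdot)$ removes both facts and sends $\mathrm{release}(x,n)$ to $B$); Release (idle $B$ with $\Phi\vdash\mathrm{RecvCount}(x,n)$ consumes $\mathrm{release}(x,n)$, adds $\mathrm{Released}(x)$, releasing $x$); Compaction (idle $C$ removes $\mathrm{Created}(x)$, $\mathrm{Released}(x)$, $\mathrm{RecvCount}(x,\cdot)$); Snapshot (an idle actor's current knowledge set is recorded as its snapshot); In (a receptionist receives $\mathrm{app}(\bot,R)$ from outside); Out ($\mathrm{app}$ messages to external actors are delivered; internal targets of contained refobs become receptionists); ReleaseOut/InfoOut drop control messages to external actors. A refob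 is unreleased from creation until its target performs Release on it. An actor is terminated if it is idle and no sequence of events leads to a configuration where it has an undelivered message. For a set of snapshots $Q$ (one per actor, $\Phi_A$ for $A$), write $A\in Q$ and $Q\vdash\phi$ if $\Phi\vdash\phi$ for some $\Phi\in Q$. $Q$ is closed if whenever $Q\vdash\mathrm{Unreleased}(x:A\to B)$ and $B\in Q$, then $A\in Q$ and $\Phi_A\vdash\mathrm{Activated}(x)$. $B\in Q$ appears blocked if for every $x:A\to B$ with $Q\vdash\mathrm{Unreleased}(x)$, $A,B\in Q$ and $\Phi_A\vdash\mathrm{SentCount}(x,n)$, $\Phi_B\vdash\mathrm{RecvCount}(x,n)$ for some $n$. $Q$ is finalized if it is closed and every actor in $Q$ appears blocked.
   Formalization: Adds the assumption that deliverable messages are eventually delivered (false without it), and Q ⊢ Unreleased(x) also requires that no snapshot in Q records Released(x), since with ¬Released(x) judged in each snapshot separately the claim fails. *)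

theory Defs
  imports Complex_Main "HOL-Library.Multiset" "HOL-Library.Extended_Nat"
begin

(* 'a: actor names, 't: tokens.  Ref x A B is the refob x : A -> B.
   Bot is the null refob carried by messages that arrive from outside. *)
datatype ('a, 't) refob = Ref (token: 't) (owner: 'a) (target: 'a) | Bot

datatype ('a, 't) fact =
    Created "('a, 't) refob"
  | Released "('a, 't) refob"
  | CreatedUsing "('a, 't) refob" "('a, 't) refob"
  | Activated "('a, 't) refob"
  | Unreleased "('a, 't) refob"
  | SentCount "('a, 't) refob" nat
  | RecvCount "('a, 't) refob" nat

type_synonym ('a, 't) knowledge = "('a, 't) fact set"

(* Derivability of atomic facts from a knowledge set.  Knowledge sets contain only positive
   facts, so the premise "not Released(x)" is read as negation as failure. *)
inductive derives :: "('a, 't) knowledge \<Rightarrow> ('a, 't) fact \<Rightarrow> bool" (infix "\<turnstile>" 50)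
  for \<Phi> :: "('a, 't) knowledge" where
  fact: "\<phi> \<in> \<Phi> \<Longrightarrow> \<Phi> \<turnstile> \<phi>"
| sent0: "\<forall>n. SentCount x n \<notin> \<Phi> \<Longrightarrow> \<Phi> \<turnstile> SentCount x 0"
| recv0: "\<forall>n. RecvCount x n \<notin> \<Phi> \<Longrightarrow> \<Phi> \<turnstile> RecvCount x 0"
| created: "\<Phi> \<turnstile> CreatedUsing x y \<Longrightarrow> \<Phi> \<turnstile> Created y"
| unreleased: "\<Phi> \<turnstile> Created x \<Longrightarrow> Released x \<notin> \<Phi> \<Longrightarrow> \<Phi> \<turnstile> Unreleased x"

definition inc_sent :: "('a, 't) refob \<Rightarrow> ('a, 't) knowledge \<Rightarrow> ('a, 't) knowledge" where
  "inc_sent x \<Phi> = (\<Phi> - range (SentCount x)) \<union> {SentCount x (Suc n) | n. \<Phi> \<turnstile> SentCount x n}"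

definition inc_recv :: "('a, 't) refob \<Rightarrow> ('a, 't) knowledge \<Rightarrow> ('a, 't) knowledge" where
  "inc_recv x \<Phi> = (\<Phi> - range (RecvCount x)) \<union> {RecvCount x (Suc n) | n. \<Phi> \<turnstile> RecvCount x n}"

datatype ('a, 't) msg =
    app "('a, 't) refob" "('a, 't) refob set"
  | info "('a, 't) refob" "('a, 't) refob" 'a
  | release "('a, 't) refob" nat

datatype status = busy | idle

(* actors, msgs, recept and ext are alpha, mu, rho and chi.  The ghost component used records
   every token ever created, so that a fresh token is new to the whole history and not merely
   absent from the current knowledge sets and messages (from which tokens may disappear). *)
record ('a, 't) config =
  actors :: "'a \<Rightarrow> (status \<times> ('a, 't) knowledge) option"
  msgs :: "'a \<Rightarrow> ('a, 't) msg multiset"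
  recept :: "'a set"
  ext :: "'a set"
  used :: "'t set"

definition initial :: "('a, 't) config \<Rightarrow> bool" where
  "initial \<kappa> \<longleftrightarrow> (\<exists>A E x y. A \<noteq> E \<and> x \<noteq> y \<and>
     \<kappa> = \<lparr>actors = [A \<mapsto> (busy, {Activated (Ref x A E), Created (Ref y A A), Activated (Ref y A A)})],
          msgs = (\<lambda>_. {#}), recept = {}, ext = {E}, used = {x, y}\<rparr>)"

definition set_actor ::
  "'a \<Rightarrow> status \<Rightarrow> ('a, 't) knowledge \<Rightarrow> ('a, 't) config \<Rightarrow> ('a, 't) config" where
  "set_actor A s \<Phi> \<kappa> = \<kappa>\<lparr>actors := (actors \<kappa>)(A \<mapsto> (s, \<Phi>))\<rparr>"

definition post :: "'a \<Rightarrow> ('a, 't) msg \<Rightarrow> ('a, 't) config \<Rightarrow> ('a, 't) config" where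
  "post B m \<kappa> = \<kappa>\<lparr>msgs := (msgs \<kappa>)(B := add_mset m (msgs \<kappa> B))\<rparr>"

definition consume :: "'a \<Rightarrow> ('a, 't) msg \<Rightarrow> ('a, 't) config \<Rightarrow> ('a, 't) config" where
  "consume B m \<kappa> = \<kappa>\<lparr>msgs := (msgs \<kappa>)(B := msgs \<kappa> B - {#m#})\<rparr>"

definition use_tokens :: "'t set \<Rightarrow> ('a, 't) config \<Rightarrow> ('a, 't) config" where
  "use_tokens T \<kappa> = \<kappa>\<lparr>used := used \<kappa> \<union> T\<rparr>"

(* Fresh refobs with owner B, tokens zs and targets Cs. *)
definition refobs :: "'a \<Rightarrow> 't list \<Rightarrow> 'a list \<Rightarrow> ('a, 't) refob set" where
  "refobs B zs Cs = {Ref (zs ! i) B (Cs ! i) | i. i < length zs}"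

datatype ('a, 't) event =
    Spawn 't 't 'a 'a
  | Send 't "'t list" "'t list" 'a 'a "'a list"
  | Receive "('a, 't) refob" 'a "('a, 't) refob set"
  | Idle 'a
  | SendInfo 't 't 'a 'a 'a
  | Info 't 't 'a 'a 'a
  | SendRelease 't 'a 'a nat
  | Release 't 'a 'a nat
  | Compaction 't 'a 'a
  | Snapshot 'a "('a, 't) knowledge"
  | In 'a "('a, 't) refob set"
  | Out "('a, 't) refob" 'a "('a, 't) refob set"
  | ReleaseOut "('a, 't) refob" 'a nat
  | InfoOut "('a, 't) refob" "('a, 't) refob" 'a 'a

inductive step :: "('a, 't) config \<Rightarrow> ('a, 't) event \<Rightarrow> ('a, 't) config \<Rightarrow> bool" where
  Spawn:
  "actors \<kappa> A = Some (busy, \<Phi>) \<Longrightarrow>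
   B \<notin> dom (actors \<kappa>) \<union> ext \<kappa> \<Longrightarrow> x \<notin> used \<kappa> \<Longrightarrow> y \<notin> used \<kappa> \<Longrightarrow> x \<noteq> y \<Longrightarrow>
   step \<kappa> (Spawn x y A B)
     (use_tokens {x, y}
       (set_actor B busy {Created (Ref x A B), Created (Ref y B B), Activated (Ref y B B)}
         (set_actor A busy (\<Phi> \<union> {Activated (Ref x A B)}) \<kappa>)))"
| Send:
  "actors \<kappa> A = Some (busy, \<Phi>) \<Longrightarrow> \<Phi> \<turnstile> Activated (Ref x A B) \<Longrightarrow>
   length ys = n \<Longrightarrow> length zs = n \<Longrightarrow> length Cs = n \<Longrightarrow>
   \<forall>i<n. \<Phi> \<turnstile> Activated (Ref (ys ! i) A (Cs ! i)) \<Longrightarrow>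
   distinct zs \<Longrightarrow> set zs \<inter> used \<kappa> = {} \<Longrightarrow>
   step \<kappa> (Send x ys zs A B Cs)
     (use_tokens (set zs)
       (post B (app (Ref x A B) (refobs B zs Cs))
         (set_actor A busy
           (inc_sent (Ref x A B) \<Phi> \<union>
             {CreatedUsing (Ref (ys ! i) A (Cs ! i)) (Ref (zs ! i) B (Cs ! i)) | i. i < n}) \<kappa>)))"
| Receive:
  "actors \<kappa> B = Some (idle, \<Phi>) \<Longrightarrow> app r R \<in># msgs \<kappa> B \<Longrightarrow>
   step \<kappa> (Receive r B R)
     (consume B (app r R) (set_actor B busy (inc_recv r \<Phi> \<union> Activated ` R) \<kappa>))"
| Idle:
  "actors \<kappa> A = Some (busy, \<Phi>) \<Longrightarrow> step \<kappa> (Idle A) (set_actor A idle \<Phi> \<kappa>)"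
| SendInfo:
  "actors \<kappa> A = Some (busy, \<Phi>) \<Longrightarrow> CreatedUsing (Ref y A C) (Ref z B C) \<in> \<Phi> \<Longrightarrow>
   step \<kappa> (SendInfo y z A B C)
     (post C (info (Ref y A C) (Ref z B C) B)
       (set_actor A busy
         (inc_sent (Ref y A C) (\<Phi> - {CreatedUsing (Ref y A C) (Ref z B C)})) \<kappa>))"
| Info:
  "actors \<kappa> C = Some (idle, \<Phi>) \<Longrightarrow> info (Ref y A C) (Ref z B C) B \<in># msgs \<kappa> C \<Longrightarrow>
   step \<kappa> (Info y z A B C)
     (consume C (info (Ref y A C) (Ref z B C) B)
       (set_actor C idle (inc_recv (Ref y A C) \<Phi> \<union> {Created (Ref z B C)}) \<kappa>))"
| SendRelease:
  "actors \<kappa> A = Some (busy, \<Phi>) \<Longrightarrow> Activated (Ref x A B) \<in> \<Phi> \<Longrightarrow>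
   \<Phi> \<turnstile> SentCount (Ref x A B) n \<Longrightarrow> \<forall>z. CreatedUsing (Ref x A B) z \<notin> \<Phi> \<Longrightarrow>
   step \<kappa> (SendRelease x A B n)
     (post B (release (Ref x A B) n)
       (set_actor A busy (\<Phi> - {Activated (Ref x A B), SentCount (Ref x A B) n}) \<kappa>))"
| Release:
  "actors \<kappa> B = Some (idle, \<Phi>) \<Longrightarrow> release (Ref x A B) n \<in># msgs \<kappa> B \<Longrightarrow>
   \<Phi> \<turnstile> RecvCount (Ref x A B) n \<Longrightarrow>
   step \<kappa> (Release x A B n)
     (consume B (release (Ref x A B) n)
       (set_actor B idle (\<Phi> \<union> {Released (Ref x A B)}) \<kappa>))"
| Compaction:
  "actors \<kappa> C = Some (idle, \<Phi>) \<Longrightarrow>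
   Created (Ref x B C) \<in> \<Phi> \<Longrightarrow> Released (Ref x B C) \<in> \<Phi> \<Longrightarrow>
   step \<kappa> (Compaction x B C)
     (set_actor C idle
       (\<Phi> - ({Created (Ref x B C), Released (Ref x B C)} \<union> range (RecvCount (Ref x B C)))) \<kappa>)"
| Snapshot:
  "actors \<kappa> A = Some (idle, \<Phi>) \<Longrightarrow> step \<kappa> (Snapshot A \<Phi>) \<kappa>"
| In:
  "A \<in> recept \<kappa> \<Longrightarrow> length Cs = length zs \<Longrightarrow>
   distinct zs \<Longrightarrow> set zs \<inter> used \<kappa> = {} \<Longrightarrow>
   set Cs \<inter> dom (actors \<kappa>) \<subseteq> recept \<kappa> \<Longrightarrow>
   step \<kappa> (In A (refobs A zs Cs))
     (use_tokens (set zs)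
       (post A (app Bot (refobs A zs Cs))
         (\<kappa>\<lparr>ext := ext \<kappa> \<union> (set Cs - dom (actors \<kappa>))\<rparr>)))"
| Out:
  "B \<in> ext \<kappa> \<Longrightarrow> app r R \<in># msgs \<kappa> B \<Longrightarrow>
   step \<kappa> (Out r B R)
     (consume B (app r R)
       (\<kappa>\<lparr>recept := recept \<kappa> \<union> {C \<in> dom (actors \<kappa>). \<exists>z D. Ref z D C \<in> R}\<rparr>))"
| ReleaseOut:
  "B \<in> ext \<kappa> \<Longrightarrow> release r n \<in># msgs \<kappa> B \<Longrightarrow>
   step \<kappa> (ReleaseOut r B n) (consume B (release r n) \<kappa>)"
| InfoOut:
  "C \<in> ext \<kappa> \<Longrightarrow> info y z B \<in># msgs \<kappa> C \<Longrightarrow>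
   step \<kappa> (InfoOut y z B C) (consume C (info y z B) \<kappa>)"

definition reachable :: "('a, 't) config \<Rightarrow> ('a, 't) config \<Rightarrow> bool" where
  "reachable = (\<lambda>\<kappa> \<kappa>'. \<exists>e. step \<kappa> e \<kappa>')\<^sup>*\<^sup>*"

definition terminated :: "('a, 't) config \<Rightarrow> 'a \<Rightarrow> bool" where
  "terminated \<kappa> A \<longleftrightarrow>
     (\<exists>\<Phi>. actors \<kappa> A = Some (idle, \<Phi>)) \<and> \<not> (\<exists>\<kappa>'. reachable \<kappa> \<kappa>' \<and> msgs \<kappa>' A \<noteq> {#})"

(* An execution with L events, finite or infinite: event e i leads from \<kappa> i to \<kappa> (Suc i). *)
definition execution ::
  "enat \<Rightarrow> (nat \<Rightarrow> ('a, 't) config) \<Rightarrow> (nat \<Rightarrow> ('a, 't) event) \<Rightarrow> bool" where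
  "execution L \<kappa> e \<longleftrightarrow> initial (\<kappa> 0) \<and> (\<forall>i. enat i < L \<longrightarrow> step (\<kappa> i) (e i) (\<kappa> (Suc i)))"

fun delivered :: "('a, 't) event \<Rightarrow> ('a \<times> ('a, 't) msg) option" where
  "delivered (Receive r B R) = Some (B, app r R)"
| "delivered (Info y z A B C) = Some (C, info (Ref y A C) (Ref z B C) B)"
| "delivered (Release x A B n) = Some (B, release (Ref x A B) n)"
| "delivered (Out r B R) = Some (B, app r R)"
| "delivered (ReleaseOut r B n) = Some (B, release r n)"
| "delivered (InfoOut y z B C) = Some (C, info y z B)"
| "delivered _ = None"

definition deliverable :: "('a, 't) config \<Rightarrow> 'a \<Rightarrow> ('a, 't) msg \<Rightarrow> bool" where
  "deliverable \<kappa> B m \<longleftrightarrow> (\<exists>e \<kappa>'. step \<kappa> e \<kappa>' \<and> delivered e = Some (B, m))"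

(* The actor model's guarantee of eventual delivery, in its weak form: no undelivered message
   stays deliverable for ever without being delivered.  Nothing is demanded for messages to an
   actor that never becomes idle, or for release messages whose count is not yet reached. *)
definition fair_delivery ::
  "enat \<Rightarrow> (nat \<Rightarrow> ('a, 't) config) \<Rightarrow> (nat \<Rightarrow> ('a, 't) event) \<Rightarrow> bool" where
  "fair_delivery L \<kappa> e \<longleftrightarrow>
     (\<forall>i B m. enat i \<le> L \<and> m \<in># msgs (\<kappa> i) B \<longrightarrow>
        (\<exists>j\<ge>i. (enat j < L \<and> delivered (e j) = Some (B, m)) \<or>
                (enat j \<le> L \<and> \<not> deliverable (\<kappa> j) B m)))"

fun snapshot_due :: "('a, 't) event \<Rightarrow> 'a option" where
  "snapshot_due (Idle A) = Some A"
| "snapshot_due (Info y z A B C) = Some C"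
| "snapshot_due (Release x A B n) = Some B"
| "snapshot_due _ = None"

definition eventual_snapshots :: "enat \<Rightarrow> (nat \<Rightarrow> ('a, 't) event) \<Rightarrow> bool" where
  "eventual_snapshots L e \<longleftrightarrow>
     (\<forall>i A. enat i < L \<and> snapshot_due (e i) = Some A \<longrightarrow>
        (\<exists>j>i. enat j < L \<and> (\<exists>\<Phi>. e j = Snapshot A \<Phi>)))"

(* A set of snapshots, one per actor: A is in Q iff A is in the domain of Q. *)
type_synonym ('a, 't) snapshots = "'a \<Rightarrow> ('a, 't) knowledge option"

definition snapshots_taken_by :: "(nat \<Rightarrow> ('a, 't) event) \<Rightarrow> nat \<Rightarrow> ('a, 't) snapshots \<Rightarrow> bool" where
  "snapshots_taken_by e j Q \<longleftrightarrow> (\<forall>A \<Phi>. Q A = Some \<Phi> \<longrightarrow> (\<exists>i<j. e i = Snapshot A \<Phi>))"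

(* The negative premise "not Released(x)" of Unreleased(x) is judged against all of Q.  An actor
   that still holds CreatedUsing(y, x) is not informed when the target of x performs Release on x,
   so its snapshot alone would count x as unreleased even if the target's snapshot in Q records
   Released(x). *)
definition Q_derives :: "('a, 't) snapshots \<Rightarrow> ('a, 't) fact \<Rightarrow> bool" (infix "\<Turnstile>" 50) where
  "Q \<Turnstile> \<phi> \<longleftrightarrow> (\<exists>\<Phi> \<in> ran Q. \<Phi> \<turnstile> \<phi>) \<and>
     (\<forall>x. \<phi> = Unreleased x \<longrightarrow> \<not> (\<exists>\<Phi> \<in> ran Q. \<Phi> \<turnstile> Released x))"

definition closed_snapshots :: "('a, 't) snapshots \<Rightarrow> bool" where
  "closed_snapshots Q \<longleftrightarrow>
     (\<forall>x A B. Q \<Turnstile> Unreleased (Ref x A B) \<and> B \<in> dom Q \<longrightarrow>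
        (\<exists>\<Phi>A. Q A = Some \<Phi>A \<and> \<Phi>A \<turnstile> Activated (Ref x A B)))"

definition appears_blocked :: "('a, 't) snapshots \<Rightarrow> 'a \<Rightarrow> bool" where
  "appears_blocked Q B \<longleftrightarrow>
     (\<forall>x A. Q \<Turnstile> Unreleased (Ref x A B) \<longrightarrow>
        (\<exists>\<Phi>A \<Phi>B n. Q A = Some \<Phi>A \<and> Q B = Some \<Phi>B \<and>
           \<Phi>A \<turnstile> SentCount (Ref x A B) n \<and> \<Phi>B \<turnstile> RecvCount (Ref x A B) n))"

definition finalized :: "('a, 't) snapshots \<Rightarrow> bool" where
  "finalized Q \<longleftrightarrow> closed_snapshots Q \<and> (\<forall>B \<in> dom Q. appears_blocked Q B)"

end

(* Call an internal actor dead if it can never become busy again; terminated actors are dead.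
   Every holder of a refob to a dead actor is dead, since a busy holder could send along it, and no
   refob to a dead actor is pending in a message or held outside.  So the set S of actors that are
   dead at time t gets no new messages.  Its pending messages are info and release messages only,
   and fairness delivers all of them: the counts balance, so a release message becomes deliverable
   once the info messages are gone.  From then on the actors of S change their knowledge by
   compaction only, which concerns released refobs.  The snapshots that they take after their last
   Idle, Info or Release event form the finalized set: a refob to S that looks unreleased is active
   at its owner, who belongs to S, and its send and receive counts agree because no message is in
   transit. *)

theory Submission
  imports Defs
begin

section \<open>Derivability and message counts\<close>

text \<open>Deadness replaces termination because termination need not pass from a target to its
  owner: an owner that never becomes busy again may still have \<open>info\<close> or
  \<open>release\<close> messages to process, and then it is not terminated. The terminated actors
  alone need not form a closed set. Snapshots of different actors are taken at different times. They
  are all compared with one later configuration, in which every inbox of S is empty. That a refob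
  which looks unreleased is active there is a counting argument. A snapshot only shows that the
  refob was announced, by a \<open>Created\<close> or \<open>CreatedUsing\<close> fact. Every refob
  is announced at most once and is in at most one of four stages of its life; if its target is
  internal and no receptionist, an announced refob is in some stage. Emptiness of the inboxes and
  deadness of the target rule out all stages but the active one. Every dead actor has a suitable
  snapshot, since actors start out busy and can only have become idle by an event after which a
  snapshot is due.\<close>

lemma derives_Activated_iff [simp]: "\<Phi> \<turnstile> Activated r \<longleftrightarrow> Activated r \<in> \<Phi>"
  by (auto elim: derives.cases intro: derives.fact)

lemma derives_Released_iff [simp]: "\<Phi> \<turnstile> Released r \<longleftrightarrow> Released r \<in> \<Phi>"
  by (auto elim: derives.cases intro: derives.fact)

lemma derives_Created_iff:
  "\<Phi> \<turnstile> Created r \<longleftrightarrow> Created r \<in> \<Phi> \<or> (\<exists>y. CreatedUsing y r \<in> \<Phi>)"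
  by (auto elim: derives.cases intro: derives.intros)

lemma derives_Unreleased_iff:
  "\<Phi> \<turnstile> Unreleased r \<longleftrightarrow> Unreleased r \<in> \<Phi> \<or> (\<Phi> \<turnstile> Created r \<and> Released r \<notin> \<Phi>)"
  by (auto elim: derives.cases intro: derives.intros)

lemma derives_SentCount_iff:
  "\<Phi> \<turnstile> SentCount r n \<longleftrightarrow> SentCount r n \<in> \<Phi> \<or> (n = 0 \<and> (\<forall>k. SentCount r k \<notin> \<Phi>))"
  by (auto elim: derives.cases intro: derives.intros)

lemma derives_RecvCount_iff:
  "\<Phi> \<turnstile> RecvCount r n \<longleftrightarrow> RecvCount r n \<in> \<Phi> \<or> (n = 0 \<and> (\<forall>k. RecvCount r k \<notin> \<Phi>))"
  by (auto elim: derives.cases intro: derives.intros)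

section \<open>Send and receive counts as natural numbers\<close>

definition single_valued_counts :: "('a, 't) knowledge \<Rightarrow> bool" where
  "single_valued_counts \<Phi> \<longleftrightarrow>
     (\<forall>r m n. SentCount r m \<in> \<Phi> \<longrightarrow> SentCount r n \<in> \<Phi> \<longrightarrow> m = n) \<and>
     (\<forall>r m n. RecvCount r m \<in> \<Phi> \<longrightarrow> RecvCount r n \<in> \<Phi> \<longrightarrow> m = n)"

text \<open>On the natural numbers \<open>Sup {} = 0\<close>, which is the default count.\<close>

definition sent :: "('a, 't) knowledge \<Rightarrow> ('a, 't) refob \<Rightarrow> nat" where
  "sent \<Phi> r = Sup {n. SentCount r n \<in> \<Phi>}"

definition recv :: "('a, 't) knowledge \<Rightarrow> ('a, 't) refob \<Rightarrow> nat" where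
  "recv \<Phi> r = Sup {n. RecvCount r n \<in> \<Phi>}"

lemma Sup_nat_eqI: "(\<And>n. n \<in> S \<longleftrightarrow> n = (k::nat)) \<Longrightarrow> Sup S = k"
proof -
  assume "\<And>n. n \<in> S \<longleftrightarrow> n = k"
  then have "S = {k}" by auto
  then show ?thesis by simp
qed

lemma sent_eqI: "single_valued_counts \<Phi> \<Longrightarrow> SentCount r n \<in> \<Phi> \<Longrightarrow> sent \<Phi> r = n"
  unfolding sent_def single_valued_counts_def by (rule Sup_nat_eqI) blast

lemma recv_eqI: "single_valued_counts \<Phi> \<Longrightarrow> RecvCount r n \<in> \<Phi> \<Longrightarrow> recv \<Phi> r = n"
  unfolding recv_def single_valued_counts_def by (rule Sup_nat_eqI) blast

lemma sent_eq_0: "(\<And>n. SentCount r n \<notin> \<Phi>) \<Longrightarrow> sent \<Phi> r = 0"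
  by (simp add: sent_def)

lemma recv_eq_0: "(\<And>n. RecvCount r n \<notin> \<Phi>) \<Longrightarrow> recv \<Phi> r = 0"
  by (simp add: recv_def)

text \<open>The rules \<open>fact\<close> and \<open>sent0\<close> together make derivability of a
  count functional, so from here on the proof calculates with numbers instead of facts.\<close>

lemma sent_iff: "single_valued_counts \<Phi> \<Longrightarrow> \<Phi> \<turnstile> SentCount r n \<longleftrightarrow> n = sent \<Phi> r"
  unfolding derives_SentCount_iff using sent_eqI sent_eq_0 by metis

lemma recv_iff: "single_valued_counts \<Phi> \<Longrightarrow> \<Phi> \<turnstile> RecvCount r n \<longleftrightarrow> n = recv \<Phi> r"
  unfolding derives_RecvCount_iff using recv_eqI recv_eq_0 by metis

lemma sent_cong: "(\<And>n. SentCount r n \<in> \<Phi> \<longleftrightarrow> SentCount r n \<in> \<Psi>) \<Longrightarrow> sent \<Phi> r = sent \<Psi> r"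
  by (simp add: sent_def)

lemma recv_cong: "(\<And>n. RecvCount r n \<in> \<Phi> \<longleftrightarrow> RecvCount r n \<in> \<Psi>) \<Longrightarrow> recv \<Phi> r = recv \<Psi> r"
  by (simp add: recv_def)

lemma inc_sent_iff:
  assumes "single_valued_counts \<Phi>"
  shows "\<phi> \<in> inc_sent r \<Phi> \<longleftrightarrow>
    (if \<phi> \<in> range (SentCount r) then \<phi> = SentCount r (Suc (sent \<Phi> r)) else \<phi> \<in> \<Phi>)"
  using assms by (auto simp: inc_sent_def sent_iff)

lemma inc_recv_iff:
  assumes "single_valued_counts \<Phi>"
  shows "\<phi> \<in> inc_recv r \<Phi> \<longleftrightarrow>
    (if \<phi> \<in> range (RecvCount r) then \<phi> = RecvCount r (Suc (recv \<Phi> r)) else \<phi> \<in> \<Phi>)"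
  using assms by (auto simp: inc_recv_def recv_iff)

lemma inc_sent_mem [simp]:
  "Created q \<in> inc_sent r \<Phi> \<longleftrightarrow> Created q \<in> \<Phi>"
  "Released q \<in> inc_sent r \<Phi> \<longleftrightarrow> Released q \<in> \<Phi>"
  "CreatedUsing p q \<in> inc_sent r \<Phi> \<longleftrightarrow> CreatedUsing p q \<in> \<Phi>"
  "Activated q \<in> inc_sent r \<Phi> \<longleftrightarrow> Activated q \<in> \<Phi>"
  "RecvCount q n \<in> inc_sent r \<Phi> \<longleftrightarrow> RecvCount q n \<in> \<Phi>"
  by (auto simp: inc_sent_def)

lemma inc_recv_mem [simp]:
  "Created q \<in> inc_recv r \<Phi> \<longleftrightarrow> Created q \<in> \<Phi>"
  "Released q \<in> inc_recv r \<Phi> \<longleftrightarrow> Released q \<in> \<Phi>"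
  "CreatedUsing p q \<in> inc_recv r \<Phi> \<longleftrightarrow> CreatedUsing p q \<in> \<Phi>"
  "Activated q \<in> inc_recv r \<Phi> \<longleftrightarrow> Activated q \<in> \<Phi>"
  "SentCount q n \<in> inc_recv r \<Phi> \<longleftrightarrow> SentCount q n \<in> \<Phi>"
  by (auto simp: inc_recv_def)

lemma single_valued_counts_subset:
  "single_valued_counts \<Phi> \<Longrightarrow>
   (\<And>r n. SentCount r n \<in> \<Psi> \<Longrightarrow> SentCount r n \<in> \<Phi>) \<Longrightarrow>
   (\<And>r n. RecvCount r n \<in> \<Psi> \<Longrightarrow> RecvCount r n \<in> \<Phi>) \<Longrightarrow> single_valued_counts \<Psi>"
  unfolding single_valued_counts_def by blast

lemma single_valued_counts_inc_sent:
  "single_valued_counts \<Phi> \<Longrightarrow> single_valued_counts (inc_sent r \<Phi>)"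
  by (subst single_valued_counts_def) (auto simp: inc_sent_iff single_valued_counts_def split: if_splits)

lemma single_valued_counts_inc_recv:
  "single_valued_counts \<Phi> \<Longrightarrow> single_valued_counts (inc_recv r \<Phi>)"
  by (subst single_valued_counts_def) (auto simp: inc_recv_iff single_valued_counts_def split: if_splits)

lemma sent_inc_sent:
  assumes "single_valued_counts \<Phi>"
  shows "sent (inc_sent r \<Phi>) q = sent \<Phi> q + of_bool (q = r)"
proof (cases "q = r")
  case True
  then show ?thesis
    using assms by (simp add: sent_eqI single_valued_counts_inc_sent inc_sent_iff)
next
  case False
  then show ?thesis using assms by (auto simp: inc_sent_iff intro!: sent_cong split: if_splits)
qed

lemma recv_inc_recv:
  assumes "single_valued_counts \<Phi>"
  shows "recv (inc_recv r \<Phi>) q = recv \<Phi> q + of_bool (q = r)"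
proof (cases "q = r")
  case True
  then show ?thesis
    using assms by (simp add: recv_eqI single_valued_counts_inc_recv inc_recv_iff)
next
  case False
  then show ?thesis using assms by (auto simp: inc_recv_iff intro!: recv_cong split: if_splits)
qed

lemma sent_inc_recv [simp]: "sent (inc_recv r \<Phi>) q = sent \<Phi> q"
  by (rule sent_cong) simp

lemma recv_inc_sent [simp]: "recv (inc_sent r \<Phi>) q = recv \<Phi> q"
  by (rule recv_cong) simp

section \<open>Configurations and their invariants\<close>

text \<open>External actors and names that are not in use get the empty set, so that the invariants
  can speak about the owner of any refob without a case distinction.\<close>

definition known :: "('a, 't) config \<Rightarrow> 'a \<Rightarrow> ('a, 't) knowledge" where
  "known \<kappa> A = (case actors \<kappa> A of None \<Rightarrow> {} | Some (s, \<Phi>) \<Rightarrow> \<Phi>)"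

lemma known_Some: "actors \<kappa> A = Some (s, \<Phi>) \<Longrightarrow> known \<kappa> A = \<Phi>"
  by (simp add: known_def)

lemma known_None: "A \<notin> dom (actors \<kappa>) \<Longrightarrow> known \<kappa> A = {}"
  by (auto simp: known_def split: option.splits)

lemma known_update [simp]:
  "known (set_actor A s \<Phi> \<kappa>) = (known \<kappa>)(A := \<Phi>)"
  "known (post B m \<kappa>) = known \<kappa>"
  "known (consume B m \<kappa>) = known \<kappa>"
  "known (use_tokens T \<kappa>) = known \<kappa>"
  "known (\<kappa>\<lparr>recept := P\<rparr>) = known \<kappa>"
  "known (\<kappa>\<lparr>ext := P\<rparr>) = known \<kappa>"
  by (auto simp: known_def fun_eq_iff set_actor_def post_def consume_def use_tokens_def)

lemma config_update [simp]:
  "actors (set_actor A s \<Phi> \<kappa>) = (actors \<kappa>)(A \<mapsto> (s, \<Phi>))"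
  "msgs (set_actor A s \<Phi> \<kappa>) = msgs \<kappa>"
  "recept (set_actor A s \<Phi> \<kappa>) = recept \<kappa>"
  "ext (set_actor A s \<Phi> \<kappa>) = ext \<kappa>"
  "used (set_actor A s \<Phi> \<kappa>) = used \<kappa>"
  "actors (post B m \<kappa>) = actors \<kappa>"
  "msgs (post B m \<kappa>) = (msgs \<kappa>)(B := add_mset m (msgs \<kappa> B))"
  "recept (post B m \<kappa>) = recept \<kappa>"
  "ext (post B m \<kappa>) = ext \<kappa>"
  "used (post B m \<kappa>) = used \<kappa>"
  "actors (consume B m \<kappa>) = actors \<kappa>"
  "msgs (consume B m \<kappa>) = (msgs \<kappa>)(B := msgs \<kappa> B - {#m#})"
  "recept (consume B m \<kappa>) = recept \<kappa>"
  "ext (consume B m \<kappa>) = ext \<kappa>"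
  "used (consume B m \<kappa>) = used \<kappa>"
  "actors (use_tokens T \<kappa>) = actors \<kappa>"
  "msgs (use_tokens T \<kappa>) = msgs \<kappa>"
  "recept (use_tokens T \<kappa>) = recept \<kappa>"
  "ext (use_tokens T \<kappa>) = ext \<kappa>"
  "used (use_tokens T \<kappa>) = used \<kappa> \<union> T"
  by (simp_all add: set_actor_def post_def consume_def use_tokens_def)

lemma refobs_mem: "q \<in> refobs B zs Cs \<longleftrightarrow> (\<exists>i < length zs. q = Ref (zs ! i) B (Cs ! i))"
  by (auto simp: refobs_def)

text \<open>\<open>U\<close> is the set of used tokens, \<open>P\<close> the set of all actors, and \<open>A\<close> the actor that holds
  the fact or receives the message.\<close>

fun wf_fact :: "'t set \<Rightarrow> 'a set \<Rightarrow> 'a \<Rightarrow> ('a, 't) fact \<Rightarrow> bool" where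
  "wf_fact U P A (Created r) \<longleftrightarrow> (\<exists>x D. r = Ref x D A \<and> x \<in> U)"
| "wf_fact U P A (Released r) \<longleftrightarrow> (\<exists>x D. r = Ref x D A \<and> x \<in> U)"
| "wf_fact U P A (CreatedUsing y z) \<longleftrightarrow>
     (\<exists>a b D C. y = Ref a A C \<and> z = Ref b D C \<and> a \<in> U \<and> b \<in> U \<and> C \<in> P)"
| "wf_fact U P A (Activated r) \<longleftrightarrow> (\<exists>x C. r = Ref x A C \<and> x \<in> U \<and> C \<in> P)"
| "wf_fact U P A (Unreleased r) \<longleftrightarrow> False"
| "wf_fact U P A (SentCount r n) \<longleftrightarrow> (\<exists>x C. r = Ref x A C \<and> x \<in> U)"
| "wf_fact U P A (RecvCount r n) \<longleftrightarrow> r = Bot \<or> (\<exists>x D. r = Ref x D A \<and> x \<in> U)"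

fun wf_msg :: "'t set \<Rightarrow> 'a set \<Rightarrow> 'a \<Rightarrow> ('a, 't) msg \<Rightarrow> bool" where
  "wf_msg U P B (app r R) \<longleftrightarrow> B \<in> P \<and> (r = Bot \<or> (\<exists>x D. r = Ref x D B \<and> x \<in> U)) \<and>
     (\<forall>q\<in>R. \<exists>z C. q = Ref z B C \<and> z \<in> U \<and> C \<in> P)"
| "wf_msg U P B (info y z D) \<longleftrightarrow> B \<in> P \<and>
     (\<exists>a b A. y = Ref a A B \<and> z = Ref b D B \<and> a \<in> U \<and> b \<in> U)"
| "wf_msg U P B (release r n) \<longleftrightarrow> B \<in> P \<and> (\<exists>x D. r = Ref x D B \<and> x \<in> U)"

lemma wf_fact_mono: "wf_fact U P A \<phi> \<Longrightarrow> U \<subseteq> U' \<Longrightarrow> P \<subseteq> P' \<Longrightarrow> wf_fact U' P' A \<phi>"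
  by (cases \<phi>) auto

lemma wf_msg_mono: "wf_msg U P B m \<Longrightarrow> U \<subseteq> U' \<Longrightarrow> P \<subseteq> P' \<Longrightarrow> wf_msg U' P' B m"
  by (cases m) (simp, blast)+

text \<open>The last conjunct makes every \<open>SendInfo\<close> a send along an active refob; it
  survives \<open>SendRelease\<close> because that rule demands that no \<open>CreatedUsing\<close>
  fact for the refob is left. Finiteness later allows a maximum over the dead actors.\<close>

definition wf_config :: "('a, 't) config \<Rightarrow> bool" where
  "wf_config \<kappa> \<longleftrightarrow>
     finite (dom (actors \<kappa>)) \<and> dom (actors \<kappa>) \<inter> ext \<kappa> = {} \<and> recept \<kappa> \<subseteq> dom (actors \<kappa>) \<and>
     (\<forall>A. \<forall>\<phi>\<in>known \<kappa> A. wf_fact (used \<kappa>) (dom (actors \<kappa>) \<union> ext \<kappa>) A \<phi>) \<and>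
     (\<forall>B m. m \<in># msgs \<kappa> B \<longrightarrow> wf_msg (used \<kappa>) (dom (actors \<kappa>) \<union> ext \<kappa>) B m) \<and>
     (\<forall>A. single_valued_counts (known \<kappa> A)) \<and>
     (\<forall>A y z. CreatedUsing y z \<in> known \<kappa> A \<longrightarrow> Activated y \<in> known \<kappa> A)"

lemma wf_configD:
  assumes "wf_config \<kappa>"
  shows "finite (dom (actors \<kappa>))"
    and "dom (actors \<kappa>) \<inter> ext \<kappa> = {}"
    and "recept \<kappa> \<subseteq> dom (actors \<kappa>)"
    and "\<phi> \<in> known \<kappa> A \<Longrightarrow> wf_fact (used \<kappa>) (dom (actors \<kappa>) \<union> ext \<kappa>) A \<phi>"
    and "m \<in># msgs \<kappa> B \<Longrightarrow> wf_msg (used \<kappa>) (dom (actors \<kappa>) \<union> ext \<kappa>) B m"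
    and "single_valued_counts (known \<kappa> A)"
    and "CreatedUsing y z \<in> known \<kappa> A \<Longrightarrow> Activated y \<in> known \<kappa> A"
  using assms unfolding wf_config_def by blast+

section \<open>Preservation of well-formedness\<close>

lemma wf_config_initial: "initial \<kappa> \<Longrightarrow> wf_config \<kappa>"
  by (auto simp: initial_def wf_config_def known_def single_valued_counts_def split: if_splits)

lemma step_mono:
  assumes "step \<kappa> e \<kappa>'"
  shows "used \<kappa> \<subseteq> used \<kappa>' \<and> dom (actors \<kappa>) \<subseteq> dom (actors \<kappa>') \<and>
    ext \<kappa> \<subseteq> ext \<kappa>' \<and> recept \<kappa> \<subseteq> recept \<kappa>'"
  using assms by cases auto

lemma step_wf_fact:
  assumes wf: "wf_config \<kappa>" and step: "step \<kappa> e \<kappa>'"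
  shows "\<forall>A. \<forall>\<phi>\<in>known \<kappa>' A. wf_fact (used \<kappa>') (dom (actors \<kappa>') \<union> ext \<kappa>') A \<phi>"
proof -
  let ?U = "used \<kappa>'" and ?P = "dom (actors \<kappa>') \<union> ext \<kappa>'"
  have U: "used \<kappa> \<subseteq> ?U" and P: "dom (actors \<kappa>) \<union> ext \<kappa> \<subseteq> ?P"
    using step_mono[OF step] by auto
  have old: "wf_fact ?U ?P A \<phi>" if "\<phi> \<in> known \<kappa> A" for A \<phi>
    using wf_fact_mono[OF wf_configD(4)[OF wf that] U P] .
  have oldm: "wf_msg ?U ?P A m" if "m \<in># msgs \<kappa> A" for A m
    using wf_msg_mono[OF wf_configD(5)[OF wf that] U P] .
  have sv: "single_valued_counts \<Phi>" if "actors \<kappa> A = Some (s, \<Phi>)" for A s \<Phi>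
    using wf_configD(6)[OF wf, of A] known_Some[OF that] by simp
  show ?thesis
    using step
  proof cases
    case (Spawn A \<Phi> B x y)
    have k: "\<phi> \<in> \<Phi> \<Longrightarrow> wf_fact ?U ?P A \<phi>" for \<phi>
      using old[of \<phi> A] known_Some[OF Spawn(3)] by simp
    show ?thesis using Spawn(1,2) k old by (auto split: if_splits)
  next
    case (Send A \<Phi> x B ys n zs Cs)
    have k: "\<phi> \<in> \<Phi> \<Longrightarrow> wf_fact ?U ?P A \<phi>" for \<phi>
      using old[of \<phi> A] known_Some[OF Send(3)] by simp
    have a: "ys ! i \<in> ?U \<and> Cs ! i \<in> ?P" if "i < n" for i
      using k[of "Activated (Ref (ys ! i) A (Cs ! i))"] Send(8) that by simp
    have b: "x \<in> ?U"
      using k[of "Activated (Ref x A B)"] Send(4) by simp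
    have c: "i < n \<Longrightarrow> zs ! i \<in> ?U" for i using Send by auto
    have new: "wf_fact ?U ?P A \<phi>" if "\<phi> \<in> known \<kappa>' A" for \<phi>
    proof -
      have "\<phi> \<in> inc_sent (Ref x A B) \<Phi> \<or>
          (\<exists>i<n. \<phi> = CreatedUsing (Ref (ys ! i) A (Cs ! i)) (Ref (zs ! i) B (Cs ! i)))"
        using that Send(2) by auto
      then show ?thesis
        using k a b c by (auto simp: inc_sent_iff[OF sv[OF Send(3)]] split: if_splits)
    qed
    show ?thesis using Send(2) old new by (auto split: if_splits)
  next
    case (Receive B \<Phi> r R)
    have k: "\<phi> \<in> \<Phi> \<Longrightarrow> wf_fact ?U ?P B \<phi>" for \<phi>
      using old[of \<phi> B] known_Some[OF Receive(3)] by simp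
    have new: "wf_fact ?U ?P B \<phi>" if "\<phi> \<in> known \<kappa>' B" for \<phi>
    proof -
      have "\<phi> \<in> inc_recv r \<Phi> \<or> (\<exists>q\<in>R. \<phi> = Activated q)"
        using that Receive(2) by auto
      then show ?thesis
        using k oldm[OF Receive(4)]
        by (auto simp: inc_recv_iff[OF sv[OF Receive(3)]] split: if_splits)
    qed
    show ?thesis using Receive(2) old new by (auto split: if_splits)
  next
    case (Idle A \<Phi>)
    then show ?thesis using old[of _ A] old known_Some[OF Idle(3)] by auto
  next
    case (SendInfo A \<Phi> y C z B)
    have k: "\<phi> \<in> \<Phi> \<Longrightarrow> wf_fact ?U ?P A \<phi>" for \<phi>
      using old[of \<phi> A] known_Some[OF SendInfo(3)] by simp
    have sv': "single_valued_counts (\<Phi> - {CreatedUsing (Ref y A C) (Ref z B C)})"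
      by (rule single_valued_counts_subset[OF sv[OF SendInfo(3)]]) auto
    have "y \<in> ?U" using k[OF SendInfo(4)] by simp
    then have new: "wf_fact ?U ?P A \<phi>" if "\<phi> \<in> known \<kappa>' A" for \<phi>
      using that SendInfo(2) k by (auto simp: inc_sent_iff[OF sv'] split: if_splits)
    show ?thesis using SendInfo(2) old new by (auto split: if_splits)
  next
    case (Info C \<Phi> y A z B)
    have k: "\<phi> \<in> \<Phi> \<Longrightarrow> wf_fact ?U ?P C \<phi>" for \<phi>
      using old[of \<phi> C] known_Some[OF Info(3)] by simp
    have new: "wf_fact ?U ?P C \<phi>" if "\<phi> \<in> known \<kappa>' C" for \<phi>
      using that Info(2) k oldm[OF Info(4)]
      by (auto simp: inc_recv_iff[OF sv[OF Info(3)]] split: if_splits)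
    show ?thesis using Info(2) old new by (auto split: if_splits)
  next
    case (SendRelease A \<Phi> x B n)
    then show ?thesis using old[of _ A] old known_Some[OF SendRelease(3)] by auto
  next
    case (Release B \<Phi> x A n)
    then show ?thesis
      using old[of _ B] old known_Some[OF Release(3)] oldm[OF Release(4)] by (auto split: if_splits)
  next
    case (Compaction C \<Phi> x B)
    then show ?thesis using old[of _ C] old known_Some[OF Compaction(3)] by auto
  qed (use old in auto)
qed

lemma step_wf_msg:
  assumes wf: "wf_config \<kappa>" and step: "step \<kappa> e \<kappa>'" and m: "m \<in># msgs \<kappa>' D"
  shows "wf_msg (used \<kappa>') (dom (actors \<kappa>') \<union> ext \<kappa>') D m"
proof -
  let ?U = "used \<kappa>'" and ?P = "dom (actors \<kappa>') \<union> ext \<kappa>'"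
  have U: "used \<kappa> \<subseteq> ?U" and P: "dom (actors \<kappa>) \<union> ext \<kappa> \<subseteq> ?P"
    using step_mono[OF step] by auto
  have k: "wf_fact ?U ?P A \<phi>" if "actors \<kappa> A = Some (s, \<Phi>)" "\<phi> \<in> \<Phi>" for A s \<Phi> \<phi>
    using wf_fact_mono[OF wf_configD(4)[OF wf] U P] known_Some[OF that(1)] that(2) by simp
  have old: "wf_msg ?U ?P D m" if "m \<in># msgs \<kappa> D"
    using wf_msg_mono[OF wf_configD(5)[OF wf that] U P] .
  have inD: "D = B" if "msgs \<kappa>' = (msgs \<kappa>)(B := add_mset m' (msgs \<kappa> B))" "\<not> m \<in># msgs \<kappa> D" for B m'
    using that m by (auto split: if_splits)
  have minus: "wf_msg ?U ?P D m" if "msgs \<kappa>' = (msgs \<kappa>)(B := msgs \<kappa> B - {#m'#})" for B m'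
    using that m old by (auto split: if_splits dest: in_diffD)
  show ?thesis
    using step
  proof cases
    case (Send A \<Phi> x B ys n zs Cs)
    have a: "Cs ! i \<in> ?P" if "i < n" for i
      using k[OF Send(3), of "Activated (Ref (ys ! i) A (Cs ! i))"] Send(8) that by simp
    have b: "x \<in> ?U \<and> B \<in> ?P"
      using k[OF Send(3), of "Activated (Ref x A B)"] Send(4) by simp
    have c: "i < n \<Longrightarrow> zs ! i \<in> ?U" for i using Send by auto
    have "wf_msg ?U ?P B (app (Ref x A B) (refobs B zs Cs))"
      using a b c Send(5,6) by (auto simp: refobs_mem)
    moreover have "m \<in># msgs \<kappa> D \<or> D = B \<and> m = app (Ref x A B) (refobs B zs Cs)"
      using m Send(2) by (auto split: if_splits)
    ultimately show ?thesis using old by auto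
  next
    case (SendInfo A \<Phi> y C z B)
    have "wf_msg ?U ?P C (info (Ref y A C) (Ref z B C) B)"
      using k[OF SendInfo(3,4)] by auto
    moreover have "m \<in># msgs \<kappa> D \<or> D = C \<and> m = info (Ref y A C) (Ref z B C) B"
      using m SendInfo(2) by (auto split: if_splits)
    ultimately show ?thesis using old by auto
  next
    case (SendRelease A \<Phi> x B n)
    have "wf_msg ?U ?P B (release (Ref x A B) n)"
      using k[OF SendRelease(3,4)] by auto
    moreover have "m \<in># msgs \<kappa> D \<or> D = B \<and> m = release (Ref x A B) n"
      using m SendRelease(2) by (auto split: if_splits)
    ultimately show ?thesis using old by auto
  next
    case (In A Cs zs)
    \<comment> \<open>Targets that are not internal have just been added to the external actors, so
      every target of a carried refob is an actor of the new configuration.\<close>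
    have "wf_msg ?U ?P A (app Bot (refobs A zs Cs))"
      using In(2-) wf_configD(3)[OF wf] by (auto simp: refobs_mem)
    moreover have "m \<in># msgs \<kappa> D \<or> D = A \<and> m = app Bot (refobs A zs Cs)"
      using m In(2) by (auto split: if_splits)
    ultimately show ?thesis using old by auto
  qed (use m old in \<open>auto split: if_splits dest: in_diffD\<close>)
qed

lemma wf_config_step:
  assumes wf: "wf_config \<kappa>" and step: "step \<kappa> e \<kappa>'"
  shows "wf_config \<kappa>'"
proof -
  have fin: "finite (dom (actors \<kappa>'))"
    using step wf_configD(1)[OF wf] by cases auto
  have disj: "dom (actors \<kappa>') \<inter> ext \<kappa>' = {}"
    using step wf_configD(2)[OF wf] by cases (auto simp: dom_def)
  have rec: "recept \<kappa>' \<subseteq> dom (actors \<kappa>')"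
    using step wf_configD(3)[OF wf] by cases auto
  have sv0: "single_valued_counts \<Phi>" if "actors \<kappa> A = Some (s, \<Phi>)" for A s \<Phi>
    using wf_configD(6)[OF wf, of A] known_Some[OF that] by simp
  have sv: "single_valued_counts (known \<kappa>' A)" for A
    using step
  proof cases
    case (Spawn B \<Phi> C x y)
    have "single_valued_counts (\<Phi> \<union> {Activated (Ref x B C)})"
      by (rule single_valued_counts_subset[OF sv0[OF Spawn(3)]]) auto
    then show ?thesis using Spawn wf_configD(6)[OF wf, of A]
      by (auto simp: single_valued_counts_def)
  next
    case (Send B \<Phi> x C ys n zs Cs)
    have "single_valued_counts (inc_sent (Ref x B C) \<Phi> \<union>
        {CreatedUsing (Ref (ys ! i) B (Cs ! i)) (Ref (zs ! i) C (Cs ! i)) | i. i < n})"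
      by (rule single_valued_counts_subset[OF single_valued_counts_inc_sent[OF sv0[OF Send(3)]]]) auto
    then show ?thesis using Send(2) wf_configD(6)[OF wf, of A] by simp
  next
    case (Receive B \<Phi> r R)
    have "single_valued_counts (inc_recv r \<Phi> \<union> Activated ` R)"
      by (rule single_valued_counts_subset[OF single_valued_counts_inc_recv[OF sv0[OF Receive(3)]]]) auto
    then show ?thesis using Receive(2) wf_configD(6)[OF wf, of A] by simp
  next
    case (SendInfo B \<Phi> y C z D)
    have "single_valued_counts (\<Phi> - {CreatedUsing (Ref y B C) (Ref z D C)})"
      by (rule single_valued_counts_subset[OF sv0[OF SendInfo(3)]]) auto
    then show ?thesis
      using SendInfo(2) wf_configD(6)[OF wf, of A] by (simp add: single_valued_counts_inc_sent)
  next
    case (Info C \<Phi> y B z D)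
    have "single_valued_counts (inc_recv (Ref y B C) \<Phi> \<union> {Created (Ref z D C)})"
      by (rule single_valued_counts_subset[OF single_valued_counts_inc_recv[OF sv0[OF Info(3)]]]) auto
    then show ?thesis using Info(2) wf_configD(6)[OF wf, of A] by simp
  next
    case (SendRelease B \<Phi> x C n)
    have "single_valued_counts (\<Phi> - {Activated (Ref x B C), SentCount (Ref x B C) n})"
      by (rule single_valued_counts_subset[OF sv0[OF SendRelease(3)]]) auto
    then show ?thesis using SendRelease(2) wf_configD(6)[OF wf, of A] by simp
  next
    case (Release B \<Phi> x C n)
    have "single_valued_counts (\<Phi> \<union> {Released (Ref x C B)})"
      by (rule single_valued_counts_subset[OF sv0[OF Release(3)]]) auto
    then show ?thesis using Release(2) wf_configD(6)[OF wf, of A] by simp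
  next
    case (Compaction C \<Phi> x B)
    have "single_valued_counts (\<Phi> - ({Created (Ref x B C), Released (Ref x B C)} \<union> range (RecvCount (Ref x B C))))"
      by (rule single_valued_counts_subset[OF sv0[OF Compaction(3)]]) auto
    then show ?thesis using Compaction(2) wf_configD(6)[OF wf, of A] by simp
  qed (use wf_configD(6)[OF wf, of A] sv0 in auto)
  have cu: "Activated y \<in> known \<kappa>' A" if "CreatedUsing y z \<in> known \<kappa>' A" for A y z
  proof -
    have k: "Activated y \<in> \<Phi>" if "actors \<kappa> A = Some (s, \<Phi>)" "CreatedUsing y z \<in> \<Phi>" for A s \<Phi> y z
      using wf_configD(7)[OF wf] known_Some[OF that(1)] that(2) by metis
    show ?thesis
      using step that wf_configD(7)[OF wf, of y z A] by cases (auto dest: k split: if_splits)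
  qed
  show ?thesis
    unfolding wf_config_def
    using fin disj rec step_wf_fact[OF wf step] step_wf_msg[OF wf step] sv cu by blast
qed

section \<open>The life cycle of a refob\<close>

definition cnt :: "('b \<Rightarrow> bool) \<Rightarrow> 'b multiset \<Rightarrow> nat" where
  "cnt P N = size (filter_mset P N)"

lemma cnt_empty [simp]: "cnt P {#} = 0"
  by (simp add: cnt_def)

lemma cnt_add_mset [simp]: "cnt P (add_mset m N) = of_bool (P m) + cnt P N"
  by (simp add: cnt_def)

lemma cnt_eq_0_iff: "cnt P N = 0 \<longleftrightarrow> (\<forall>m. m \<in># N \<longrightarrow> \<not> P m)"
  by (auto simp: cnt_def filter_mset_eq_mempty_iff)

fun carries :: "('a, 't) refob \<Rightarrow> ('a, 't) msg \<Rightarrow> bool" where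
  "carries r (app s R) \<longleftrightarrow> r \<in> R"
| "carries r (info y z D) \<longleftrightarrow> False"
| "carries r (release s n) \<longleftrightarrow> False"

fun releases :: "('a, 't) refob \<Rightarrow> ('a, 't) msg \<Rightarrow> bool" where
  "releases r (app s R) \<longleftrightarrow> False"
| "releases r (info y z D) \<longleftrightarrow> False"
| "releases r (release s n) \<longleftrightarrow> s = r"

fun sent_along :: "('a, 't) refob \<Rightarrow> ('a, 't) msg \<Rightarrow> bool" where
  "sent_along r (app s R) \<longleftrightarrow> s = r"
| "sent_along r (info y z D) \<longleftrightarrow> y = r"
| "sent_along r (release s n) \<longleftrightarrow> False"

fun announces :: "('a, 't) refob \<Rightarrow> ('a, 't) msg \<Rightarrow> bool" where
  "announces r (app s R) \<longleftrightarrow> False"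
| "announces r (info y z D) \<longleftrightarrow> z = r"
| "announces r (release s n) \<longleftrightarrow> False"

text \<open>A refob passes through four stages: it is carried by a message to its owner, it is
  active, its release is under way, it is released.  An external owner takes it out of all of
  them, and compaction by the target ends the last one.\<close>

definition stage :: "('a, 't) config \<Rightarrow> ('a, 't) refob \<Rightarrow> nat" where
  "stage \<kappa> r = cnt (carries r) (msgs \<kappa> (owner r)) + of_bool (Activated r \<in> known \<kappa> (owner r)) +
     cnt (releases r) (msgs \<kappa> (target r)) + of_bool (Released r \<in> known \<kappa> (target r))"

text \<open>These are the places from which \<open>Created r\<close> is derived or will be learned.
  The \<open>CreatedUsing\<close> facts of all actors give a single truth value, since there may be
  infinitely many names to sum over; that this loses nothing is the uniqueness part of
  \<open>life_cycle\<close>.\<close>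

definition announced :: "('a, 't) config \<Rightarrow> ('a, 't) refob \<Rightarrow> nat" where
  "announced \<kappa> r = cnt (announces r) (msgs \<kappa> (target r)) +
     of_bool (Created r \<in> known \<kappa> (target r)) + of_bool (\<exists>A y. CreatedUsing y r \<in> known \<kappa> A)"

text \<open>The value that the receive count is heading for. Delivery to an internal target leaves
  it unchanged, which makes it the right partner for the send count.\<close>

definition arrivals :: "('a, 't) config \<Rightarrow> ('a, 't) refob \<Rightarrow> nat" where
  "arrivals \<kappa> r = recv (known \<kappa> (target r)) r + cnt (sent_along r) (msgs \<kappa> (target r))"

text \<open>The final inequality fails at the border to the outside. A refob delivered to an
  external owner leaves all stages, but then \<open>Out\<close> turns its internal target into a
  receptionist; a release message to an external target is dropped without a trace. Hence only
  internal targets that are no receptionists are covered.\<close>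

definition life_cycle :: "('a, 't) config \<Rightarrow> bool" where
  "life_cycle \<kappa> \<longleftrightarrow> (\<forall>x D B.
     stage \<kappa> (Ref x D B) \<le> 1 \<and> announced \<kappa> (Ref x D B) \<le> 1 \<and>
     (\<forall>y y' A A'. CreatedUsing y (Ref x D B) \<in> known \<kappa> A \<longrightarrow>
        CreatedUsing y' (Ref x D B) \<in> known \<kappa> A' \<longrightarrow> y = y') \<and>
     (B \<in> dom (actors \<kappa>) - recept \<kappa> \<longrightarrow> announced \<kappa> (Ref x D B) \<le> stage \<kappa> (Ref x D B)))"

text \<open>External targets are excluded because messages to them are consumed without being
  counted. The clause for carried refobs ensures that a refob is already balanced when
  \<open>Receive\<close> activates it.\<close>

definition balanced :: "('a, 't) config \<Rightarrow> bool" where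
  "balanced \<kappa> \<longleftrightarrow> (\<forall>x D B. B \<in> dom (actors \<kappa>) \<longrightarrow>
     (Activated (Ref x D B) \<in> known \<kappa> D \<or> cnt (carries (Ref x D B)) (msgs \<kappa> D) > 0 \<longrightarrow>
        sent (known \<kappa> D) (Ref x D B) = arrivals \<kappa> (Ref x D B)) \<and>
     (\<forall>n. release (Ref x D B) n \<in># msgs \<kappa> B \<longrightarrow> n = arrivals \<kappa> (Ref x D B)))"

text \<open>Starting values for the counters of a refob. Besides a fresh token, a fresh target
  matters: \<open>Spawn\<close> puts its new actor under the invariants only in the new
  configuration, and the old values for refobs to it are needed as well.\<close>

lemma wf_config_absent:
  fixes D :: 'a
  assumes wf: "wf_config \<kappa>"
    and x: "x \<notin> used \<kappa> \<or> B \<notin> dom (actors \<kappa>) \<union> ext \<kappa>"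
  defines "r \<equiv> Ref x D B"
  shows "Activated r \<notin> known \<kappa> A"
    and "CreatedUsing y r \<notin> known \<kappa> A"
    and "Released r \<notin> known \<kappa> B"
    and "Created r \<notin> known \<kappa> B"
    and "cnt (carries r) (msgs \<kappa> A) = 0"
    and "cnt (releases r) (msgs \<kappa> B) = 0"
    and "cnt (announces r) (msgs \<kappa> B) = 0"
    and "x \<notin> used \<kappa> \<Longrightarrow> sent (known \<kappa> A) r = 0"
    and "arrivals \<kappa> r = 0"
proof -
  note f = wf_configD(4)[OF wf] and m = wf_configD(5)[OF wf]
  \<comment> \<open>Every well-formed message has an actor as its recipient, so a name that is no
    actor has an empty inbox.\<close>
  have none: "known \<kappa> B = {}" "msgs \<kappa> B = {#}" if "B \<notin> dom (actors \<kappa>) \<union> ext \<kappa>"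
  proof -
    show "known \<kappa> B = {}" using that known_None by fast
    have "\<not> m \<in># msgs \<kappa> B" for m using m[of m B] that by (cases m) auto
    then show "msgs \<kappa> B = {#}" by (meson multiset_nonemptyE)
  qed
  show "Activated r \<notin> known \<kappa> A" "CreatedUsing y r \<notin> known \<kappa> A" for A y
    using x f[of "Activated r" A] f[of "CreatedUsing y r" A] by (auto simp: r_def)
  have unused: "x \<notin> used \<kappa>" if "\<phi> \<in> known \<kappa> B" for \<phi>
    using x none(1) that by auto
  show "Released r \<notin> known \<kappa> B"
  proof
    assume *: "Released r \<in> known \<kappa> B"
    show False using f[OF *] unused[OF *] by (simp add: r_def)
  qed
  show "Created r \<notin> known \<kappa> B"
  proof
    assume *: "Created r \<in> known \<kappa> B"
    show False using f[OF *] unused[OF *] by (simp add: r_def)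
  qed
  have "\<not> carries r m'" if "m' \<in># msgs \<kappa> A" for m' A
    using x m[OF that] by (cases m') (auto simp: r_def)
  then show "cnt (carries r) (msgs \<kappa> A) = 0" by (simp add: cnt_eq_0_iff)
  have "\<not> releases r m'" "\<not> announces r m'" "\<not> sent_along r m'" if "m' \<in># msgs \<kappa> B" for m'
  proof -
    have "msgs \<kappa> B \<noteq> {#}" using that by auto
    then have "x \<notin> used \<kappa>" using x none(2) by blast
    then show "\<not> releases r m'" "\<not> announces r m'" "\<not> sent_along r m'"
      using m[OF that] by (cases m'; auto simp: r_def)+
  qed
  then have c: "cnt (releases r) (msgs \<kappa> B) = 0" "cnt (announces r) (msgs \<kappa> B) = 0"
      "cnt (sent_along r) (msgs \<kappa> B) = 0"
    by (simp_all add: cnt_eq_0_iff)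
  then show "cnt (releases r) (msgs \<kappa> B) = 0" "cnt (announces r) (msgs \<kappa> B) = 0"
    by simp_all
  have "RecvCount r n \<notin> known \<kappa> B" for n
  proof
    assume *: "RecvCount r n \<in> known \<kappa> B"
    show False using f[OF *] unused[OF *] by (simp add: r_def)
  qed
  then show "arrivals \<kappa> r = 0"
    using c(3) by (simp add: arrivals_def r_def recv_eq_0)
  show "sent (known \<kappa> A) r = 0" if "x \<notin> used \<kappa>"
    using f[of "SentCount r _" A] that by (auto simp: r_def intro!: sent_eq_0)
qed

lemma absent_stage_announced:
  assumes wf: "wf_config \<kappa>"
    and x: "x \<notin> used \<kappa> \<or> B \<notin> dom (actors \<kappa>) \<union> ext \<kappa>"
  shows "stage \<kappa> (Ref x D B) = 0" and "announced \<kappa> (Ref x D B) = 0"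
  by (simp_all add: stage_def announced_def wf_config_absent[OF wf x])

section \<open>Preservation of the life cycle and of the balance\<close>

lemma cnt_minus: "m \<in># N \<Longrightarrow> cnt P (N - {#m#}) + of_bool (P m) = cnt P N"
  by (metis add.commute cnt_add_mset insert_DiffM)

lemma cnt_minus_le: "cnt P (N - {#m#}) \<le> cnt P N"
  by (simp add: cnt_def filter_mset_eq_conv size_mset_mono multiset_filter_mono)

text \<open>A refob enters a summand by leaving an earlier one: \<open>Receive\<close> takes it from
  a message to its owner, \<open>SendRelease\<close> from the owner to a release message,
  \<open>Release\<close> from there to the target. Only fresh tokens enter from nowhere, and for
  them all summands were zero.\<close>

lemma stage_step:
  assumes wf: "wf_config \<kappa>" and old: "stage \<kappa> (Ref x D B) \<le> 1" and step: "step \<kappa> e \<kappa>'"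
  shows "stage \<kappa>' (Ref x D B) \<le> 1"
proof -
  let ?r = "Ref x D B"
  let ?c = "\<lambda>\<kappa>. cnt (carries ?r) (msgs \<kappa> D)"
    and ?a = "\<lambda>\<kappa>. Activated ?r \<in> known \<kappa> D"
    and ?d = "\<lambda>\<kappa>. cnt (releases ?r) (msgs \<kappa> B)"
    and ?b = "\<lambda>\<kappa>. Released ?r \<in> known \<kappa> B"
  have st: "stage \<kappa> ?r = ?c \<kappa> + of_bool (?a \<kappa>) + ?d \<kappa> + of_bool (?b \<kappa>)" for \<kappa> :: "('a, 'b) config"
    by (simp add: stage_def)
  have abs: "?c \<kappa> = 0 \<and> \<not> ?a \<kappa> \<and> ?d \<kappa> = 0 \<and> \<not> ?b \<kappa>" if "x \<notin> used \<kappa>"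
    using absent_stage_announced(1)[OF wf, of x B D] that st[of \<kappa>] by simp
  have k: "known \<kappa> A = \<Phi>" if "actors \<kappa> A = Some (s, \<Phi>)" for A s \<Phi>
    by (rule known_Some[OF that])
  \<comment> \<open>This settles every rule that increases none of the four summands.\<close>
  have keep: ?thesis
    if "?a \<kappa>' \<longrightarrow> ?a \<kappa>" "?b \<kappa>' \<longrightarrow> ?b \<kappa>" "?c \<kappa>' \<le> ?c \<kappa>" "?d \<kappa>' \<le> ?d \<kappa>"
  proof -
    have "of_bool (?a \<kappa>') \<le> (of_bool (?a \<kappa>) :: nat)" "of_bool (?b \<kappa>') \<le> (of_bool (?b \<kappa>) :: nat)"
      using that(1,2) by simp_all
    then show ?thesis using old that(3,4) unfolding st by linarith
  qed
  show ?thesis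
    using step
  proof cases
    case (Spawn A \<Phi> B' x0 y0)
    have n: "known \<kappa> B' = {}" using known_None Spawn(4) by fast
    have m: "msgs \<kappa>' = msgs \<kappa>" using Spawn(2) by simp
    have b: "?b \<kappa>' \<longrightarrow> ?b \<kappa>" using Spawn(2) n k[OF Spawn(3)] by auto
    show ?thesis
    proof (cases "x = x0 \<or> x = y0")
      case True
      then have "x \<notin> used \<kappa>" using Spawn(5,6) by auto
      from abs[OF this] show ?thesis using m b unfolding st by simp
    next
      case False
      then have "?a \<kappa>' \<longrightarrow> ?a \<kappa>" using Spawn(2) n k[OF Spawn(3)] by auto
      then show ?thesis using m b by (intro keep) auto
    qed
  next
    case (Send A \<Phi> x0 B' ys n zs Cs)
    have a: "?a \<kappa>' \<longrightarrow> ?a \<kappa>" and b: "?b \<kappa>' \<longrightarrow> ?b \<kappa>"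
      using Send(2) k[OF Send(3)] by auto
    have c: "?c \<kappa>' \<le> ?c \<kappa> + of_bool (?r \<in> refobs B' zs Cs)" and d: "?d \<kappa>' = ?d \<kappa>"
      using Send(2) by auto
    show ?thesis
    proof (cases "x \<in> set zs")
      case True
      then have "x \<notin> used \<kappa>" using Send by auto
      from abs[OF this] show ?thesis
        using a b c d unfolding st by (simp add: of_bool_def split: if_splits)
    next
      case False
      then have "?r \<notin> refobs B' zs Cs" by (auto simp: refobs_mem)
      then show ?thesis using a b c d by (intro keep) auto
    qed
  next
    case (Receive B' \<Phi> s R)
    have b: "?b \<kappa>' \<longrightarrow> ?b \<kappa>" using Receive(2) k[OF Receive(3)] by auto
    have c: "?c \<kappa>' + of_bool (D = B' \<and> ?r \<in> R) = ?c \<kappa>" and d: "?d \<kappa>' = ?d \<kappa>"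
      using Receive(2) cnt_minus[OF Receive(4), of "carries ?r"]
        cnt_minus[OF Receive(4), of "releases ?r"] by auto
    show ?thesis
    proof (cases "D = B' \<and> ?r \<in> R")
      case True
      then have "?c \<kappa> = Suc (?c \<kappa>')" using c by auto
      moreover have "of_bool (?a \<kappa>') \<le> (1::nat)" by simp
      moreover have "of_bool (?b \<kappa>') \<le> (of_bool (?b \<kappa>) :: nat)" using b by simp
      ultimately show ?thesis using old d unfolding st by linarith
    next
      case False
      then have "?a \<kappa>' \<longrightarrow> ?a \<kappa>" using Receive(2) k[OF Receive(3)] by auto
      then show ?thesis using False b c d by (intro keep) auto
    qed
  next
    case (SendRelease A \<Phi> x0 B' n)
    have b: "?b \<kappa>' \<longrightarrow> ?b \<kappa>" and c: "?c \<kappa>' = ?c \<kappa>"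
      and d: "?d \<kappa>' = ?d \<kappa> + of_bool (?r = Ref x0 A B')"
      and a: "?a \<kappa>' \<longleftrightarrow> ?a \<kappa> \<and> ?r \<noteq> Ref x0 A B'"
      using SendRelease(2) k[OF SendRelease(3)] by auto
    show ?thesis
    proof (cases "?r = Ref x0 A B'")
      case True
      then have "?a \<kappa>" "\<not> ?a \<kappa>'" using SendRelease(4) k[OF SendRelease(3)] a by auto
      moreover have "of_bool (?b \<kappa>') \<le> (of_bool (?b \<kappa>) :: nat)" using b by simp
      ultimately show ?thesis using old c d True unfolding st by simp
    next
      case False
      then show ?thesis using a b c d by (intro keep) auto
    qed
  next
    case (Release B' \<Phi> x0 A n)
    have a: "?a \<kappa>' \<longrightarrow> ?a \<kappa>" and b: "?b \<kappa>' \<longleftrightarrow> ?b \<kappa> \<or> ?r = Ref x0 A B'"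
      using Release(2) k[OF Release(3)] by auto
    have c: "?c \<kappa>' = ?c \<kappa>" and d: "?d \<kappa>' + of_bool (?r = Ref x0 A B') = ?d \<kappa>"
      using Release(2) cnt_minus[OF Release(4), of "carries ?r"]
        cnt_minus[OF Release(4), of "releases ?r"] by auto
    show ?thesis
    proof (cases "?r = Ref x0 A B'")
      case True
      then have "?d \<kappa> = Suc (?d \<kappa>')" using d by simp
      moreover have "of_bool (?a \<kappa>') \<le> (of_bool (?a \<kappa>) :: nat)" using a by simp
      moreover have "of_bool (?b \<kappa>') \<le> (1::nat)" by simp
      ultimately show ?thesis using old c unfolding st by linarith
    next
      case False
      then show ?thesis using a b c d by (intro keep) auto
    qed
  next
    case (In A Cs zs)
    have a: "?a \<kappa>' \<longrightarrow> ?a \<kappa>" and b: "?b \<kappa>' \<longrightarrow> ?b \<kappa>" using In(2) by auto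
    have c: "?c \<kappa>' \<le> ?c \<kappa> + of_bool (?r \<in> refobs A zs Cs)" and d: "?d \<kappa>' = ?d \<kappa>"
      using In(2) by auto
    show ?thesis
    proof (cases "x \<in> set zs")
      case True
      then have "x \<notin> used \<kappa>" using In by auto
      from abs[OF this] show ?thesis
        using a b c d unfolding st by (simp add: of_bool_def split: if_splits)
    next
      case False
      then have "?r \<notin> refobs A zs Cs" using In by (auto simp: refobs_mem)
      then show ?thesis using a b c d by (intro keep) auto
    qed
  next
    case (Info C \<Phi> y A z B')
    then show ?thesis using k[OF Info(3)] by (intro keep) (auto simp: cnt_minus_le)
  next
    case (Idle A \<Phi>)
    then show ?thesis using k[OF Idle(3)] by (intro keep) auto
  next
    case (SendInfo A \<Phi> y C z B')
    then show ?thesis using k[OF SendInfo(3)] by (intro keep) auto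
  next
    case (Compaction C \<Phi> x0 B')
    then show ?thesis using k[OF Compaction(3)] by (intro keep) auto
  qed (intro keep; auto simp: cnt_minus_le)+
qed

text \<open>An announcement moves from a \<open>CreatedUsing\<close> fact to an \<open>info\<close>
  message and on to a \<open>Created\<close> fact; only fresh tokens start one. Uniqueness is
  carried along because of \<open>SendInfo\<close>: the summand for \<open>CreatedUsing\<close> is a
  truth value and drops only if the removed fact was the last one.\<close>

lemma announced_step:
  assumes wf: "wf_config \<kappa>" and life: "life_cycle \<kappa>" and step: "step \<kappa> e \<kappa>'"
  shows "announced \<kappa>' (Ref x D B) \<le> 1 \<and>
    (\<forall>y y' A A'. CreatedUsing y (Ref x D B) \<in> known \<kappa>' A \<longrightarrow>
      CreatedUsing y' (Ref x D B) \<in> known \<kappa>' A' \<longrightarrow> y = y')" (is "_ \<and> ?uniq \<kappa>'")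
proof -
  let ?r = "Ref x D B"
  let ?i = "\<lambda>\<kappa>. cnt (announces ?r) (msgs \<kappa> B)"
    and ?c = "\<lambda>\<kappa>. Created ?r \<in> known \<kappa> B"
    and ?u = "\<lambda>\<kappa> y A. CreatedUsing y ?r \<in> known \<kappa> A"
  have st: "announced \<kappa> ?r = ?i \<kappa> + of_bool (?c \<kappa>) + of_bool (\<exists>A y. ?u \<kappa> y A)"
    for \<kappa> :: "('a, 'b) config"
    by (simp add: announced_def)
  have ann: "announced \<kappa> ?r \<le> 1" and uniq: "?uniq \<kappa>"
    using life unfolding life_cycle_def by blast+
  have abs: "?i \<kappa> = 0 \<and> \<not> ?c \<kappa> \<and> \<not> (\<exists>A y. ?u \<kappa> y A)" if "x \<notin> used \<kappa>"
    using absent_stage_announced(2)[OF wf, of x B D] that st[of \<kappa>] by simp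
  have k: "known \<kappa> A = \<Phi>" if "actors \<kappa> A = Some (s, \<Phi>)" for A s \<Phi>
    by (rule known_Some[OF that])
  have keep: ?thesis
    if "?c \<kappa>' \<longrightarrow> ?c \<kappa>" "\<And>y A. ?u \<kappa>' y A \<longrightarrow> ?u \<kappa> y A" "?i \<kappa>' \<le> ?i \<kappa>"
  proof -
    have "of_bool (?c \<kappa>') \<le> (of_bool (?c \<kappa>) :: nat)"
      "of_bool (\<exists>A y. ?u \<kappa>' y A) \<le> (of_bool (\<exists>A y. ?u \<kappa> y A) :: nat)"
      using that(1,2) by auto
    then have "announced \<kappa>' ?r \<le> 1" using ann that(3) unfolding st by linarith
    then show ?thesis using uniq that(2) by blast
  qed
  show ?thesis
    using step
  proof cases
    case (Spawn A \<Phi> B' x0 y0)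
    have n: "known \<kappa> B' = {}" using known_None Spawn(4) by fast
    have u: "?u \<kappa>' y C \<longleftrightarrow> ?u \<kappa> y C" for y C
      using Spawn(2) n k[OF Spawn(3)] by auto
    have i: "?i \<kappa>' = ?i \<kappa>" using Spawn(2) by simp
    show ?thesis
    proof (cases "x = x0 \<or> x = y0")
      case True
      then have "x \<notin> used \<kappa>" using Spawn(5,6) by auto
      from abs[OF this] show ?thesis using u i unfolding st by simp
    next
      case False
      then have "?c \<kappa>' \<longrightarrow> ?c \<kappa>" using Spawn(2) n k[OF Spawn(3)] by auto
      then show ?thesis using u i by (intro keep) auto
    qed
  next
    case (Send A \<Phi> x0 B' ys n zs Cs)
    have c: "?c \<kappa>' \<longrightarrow> ?c \<kappa>" and i: "?i \<kappa>' = ?i \<kappa>"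
      using Send(2) k[OF Send(3)] by auto
    have u: "?u \<kappa> y A' \<or> (\<exists>i<n. zs ! i = x \<and> y = Ref (ys ! i) A (Cs ! i))"
      if "?u \<kappa>' y A'" for y A'
      using that Send(2) k[OF Send(3)] by (auto split: if_splits)
    show ?thesis
    proof (cases "x \<in> set zs")
      case True
      then have "x \<notin> used \<kappa>" using Send(10) by auto
      note 0 = abs[OF this]
      then have "announced \<kappa>' ?r \<le> 1" using c i unfolding st by simp
      \<comment> \<open>A fresh token had no \<open>CreatedUsing\<close> fact before, and since
        \<open>zs\<close> is distinct, only one index can supply a new one.\<close>
      moreover have "?uniq \<kappa>'"
        using 0 u Send(6,9) by (metis nth_eq_iff_index_eq)
      ultimately show ?thesis ..
    next
      case False
      then have "?u \<kappa>' y C \<longrightarrow> ?u \<kappa> y C" for y C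
        using u[of y C] Send(6) by auto
      then show ?thesis using c i by (intro keep) auto
    qed
  next
    case (Info C \<Phi> y A z B')
    have c: "?c \<kappa>' \<longleftrightarrow> ?c \<kappa> \<or> ?r = Ref z B' C"
      using Info(2) k[OF Info(3)] by auto
    have u: "?u \<kappa>' y A' \<longrightarrow> ?u \<kappa> y A'" for y A'
      using Info(2) k[OF Info(3)] by auto
    have i: "?i \<kappa>' + of_bool (?r = Ref z B' C) = ?i \<kappa>"
      using Info(2) cnt_minus[OF Info(4), of "announces ?r"] by auto
    show ?thesis
    proof (cases "?r = Ref z B' C")
      case True
      then have "?i \<kappa> = Suc (?i \<kappa>')" using i by simp
      moreover have "of_bool (?c \<kappa>') \<le> (1 :: nat)"
        "of_bool (\<exists>A y. ?u \<kappa>' y A) \<le> (of_bool (\<exists>A y. ?u \<kappa> y A) :: nat)"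
        using u by auto
      ultimately have "announced \<kappa>' ?r \<le> 1" using ann unfolding st by linarith
      then show ?thesis using u uniq by blast
    next
      case False
      then show ?thesis using u c i by (intro keep) auto
    qed
  next
    case (SendInfo A \<Phi> y0 C z0 B')
    have c: "?c \<kappa>' \<longrightarrow> ?c \<kappa>" and u: "?u \<kappa>' y A \<longrightarrow> ?u \<kappa> y A" for y A
      using SendInfo(2) k[OF SendInfo(3)] by auto
    have i: "?i \<kappa>' = ?i \<kappa> + of_bool (?r = Ref z0 B' C)"
      using SendInfo(2) by auto
    show ?thesis
    proof (cases "?r = Ref z0 B' C")
      case True
      have 0: "?u \<kappa> (Ref y0 A C) A" using SendInfo(4) k[OF SendInfo(3)] True by simp
      have "\<not> ?u \<kappa>' y A'" for y A'
      proof
        assume *: "?u \<kappa>' y A'"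
        then have y: "y = Ref y0 A C" using 0 u uniq by blast
        \<comment> \<open>The owner of \<open>y\<close> is the actor that holds the fact, so the
          fact just removed was the only one about the refob.\<close>
        moreover have "A' = A" using wf_configD(4)[OF wf, of _ A'] u * y by fastforce
        ultimately show False using * SendInfo(2) True by auto
      qed
      moreover have "of_bool (?c \<kappa>') \<le> (of_bool (?c \<kappa>) :: nat)" using c by simp
      moreover have "\<exists>A y. ?u \<kappa> y A" using 0 by blast
      ultimately have "announced \<kappa>' ?r \<le> announced \<kappa> ?r"
        unfolding st using True i by simp
      then show ?thesis using ann uniq u by (meson order_trans)
    next
      case False
      then show ?thesis using u c i by (intro keep) auto
    qed
  next
    case (Receive B' \<Phi> s R)
    then show ?thesis using k[OF Receive(3)] by (intro keep) (auto simp: cnt_minus_le)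
  next
    case (Release B' \<Phi> x0 A n)
    then show ?thesis using k[OF Release(3)] by (intro keep) (auto simp: cnt_minus_le)
  next
    case (SendRelease A \<Phi> x0 B' n)
    then show ?thesis using k[OF SendRelease(3)] by (intro keep) auto
  next
    case (Idle A \<Phi>)
    then show ?thesis using k[OF Idle(3)] by (intro keep) auto
  next
    case (Compaction C \<Phi> x0 B')
    then show ?thesis using k[OF Compaction(3)] by (intro keep) auto
  qed (intro keep; auto simp: cnt_minus_le)+
qed

text \<open>A refob that is newly announced is put into a stage by the same event. Afterwards it
  loses its stage without entering the next one only by \<open>Compaction\<close>, which removes the
  announcement too, or at the border to the outside, which the assumption on \<open>B\<close>
  excludes.\<close>

lemma announced_le_stage_step:
  assumes wf: "wf_config \<kappa>" and life: "life_cycle \<kappa>" and step: "step \<kappa> e \<kappa>'"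
    and B: "B \<in> dom (actors \<kappa>') - recept \<kappa>'"
  shows "announced \<kappa>' (Ref x D B) \<le> stage \<kappa>' (Ref x D B)"
proof -
  let ?r = "Ref x D B"
  let ?c = "\<lambda>\<kappa>. cnt (carries ?r) (msgs \<kappa> D)"
    and ?a = "\<lambda>\<kappa>. Activated ?r \<in> known \<kappa> D"
    and ?d = "\<lambda>\<kappa>. cnt (releases ?r) (msgs \<kappa> B)"
    and ?b = "\<lambda>\<kappa>. Released ?r \<in> known \<kappa> B"
  let ?i = "\<lambda>\<kappa>. cnt (announces ?r) (msgs \<kappa> B)"
    and ?n = "\<lambda>\<kappa>. Created ?r \<in> known \<kappa> B"
    and ?u = "\<lambda>\<kappa> y A. CreatedUsing y ?r \<in> known \<kappa> A"
  have st: "stage \<kappa> ?r = ?c \<kappa> + of_bool (?a \<kappa>) + ?d \<kappa> + of_bool (?b \<kappa>)" for \<kappa> :: "('a, 'b) config"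
    by (simp add: stage_def)
  have an: "announced \<kappa> ?r = ?i \<kappa> + of_bool (?n \<kappa>) + of_bool (\<exists>A y. ?u \<kappa> y A)"
    for \<kappa> :: "('a, 'b) config"
    by (simp add: announced_def)
  have ann: "announced \<kappa> ?r \<le> 1" using life unfolding life_cycle_def by blast
  have ann': "announced \<kappa>' ?r \<le> 1" using announced_step[OF wf life step] by blast
  have "B \<notin> recept \<kappa>" using B step_mono[OF step] by blast
  \<comment> \<open>If this step spawns \<open>B\<close>, the invariant says nothing about
    \<open>B\<close> before it; but then no announcement existed either.\<close>
  then have old: "announced \<kappa> ?r \<le> stage \<kappa> ?r"
    if "B \<in> dom (actors \<kappa>) \<or> B \<notin> dom (actors \<kappa>) \<union> ext \<kappa>"
    using that life absent_stage_announced(2)[OF wf, of x B D] unfolding life_cycle_def by fastforce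
  have k: "known \<kappa> A = \<Phi>" if "actors \<kappa> A = Some (s, \<Phi>)" for A s \<Phi>
    by (rule known_Some[OF that])
  have keep_st: "stage \<kappa> ?r \<le> stage \<kappa>' ?r"
    if "?a \<kappa> \<longrightarrow> ?a \<kappa>'" "?b \<kappa> \<longrightarrow> ?b \<kappa>'" "?c \<kappa> \<le> ?c \<kappa>'" "?d \<kappa> \<le> ?d \<kappa>'"
  proof -
    have "of_bool (?a \<kappa>) \<le> (of_bool (?a \<kappa>') :: nat)" "of_bool (?b \<kappa>) \<le> (of_bool (?b \<kappa>') :: nat)"
      using that(1,2) by simp_all
    then show ?thesis using that(3,4) unfolding st by linarith
  qed
  have keep: ?thesis
    if "?a \<kappa> \<longrightarrow> ?a \<kappa>'" "?b \<kappa> \<longrightarrow> ?b \<kappa>'" "?c \<kappa> \<le> ?c \<kappa>'" "?d \<kappa> \<le> ?d \<kappa>'"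
      "?n \<kappa>' \<longrightarrow> ?n \<kappa>" "\<And>y A. ?u \<kappa>' y A \<longrightarrow> ?u \<kappa> y A" "?i \<kappa>' \<le> ?i \<kappa>"
      "B \<in> dom (actors \<kappa>) \<or> B \<notin> dom (actors \<kappa>) \<union> ext \<kappa>"
  proof -
    have "of_bool (?n \<kappa>') \<le> (of_bool (?n \<kappa>) :: nat)"
      "of_bool (\<exists>A y. ?u \<kappa>' y A) \<le> (of_bool (\<exists>A y. ?u \<kappa> y A) :: nat)"
      using that(5,6) by auto
    then have "announced \<kappa>' ?r \<le> announced \<kappa> ?r" using that(7) unfolding an by linarith
    then show ?thesis using old[OF that(8)] keep_st[OF that(1-4)] by linarith
  qed
  \<comment> \<open>Announcements never exceed one, so any occupied stage in the new configuration
    suffices.\<close>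
  have one: ?thesis if "?a \<kappa>' \<or> ?b \<kappa>' \<or> ?c \<kappa>' > 0 \<or> ?d \<kappa>' > 0"
  proof -
    have "stage \<kappa>' ?r \<noteq> 0" using that unfolding st by auto
    then show ?thesis using ann' by linarith
  qed
  show ?thesis
    using step
  proof cases
    case (Spawn A \<Phi> B' x0 y0)
    have n: "known \<kappa> B' = {}" using known_None Spawn(4) by fast
    have B': "B \<in> dom (actors \<kappa>) \<or> B \<notin> dom (actors \<kappa>) \<union> ext \<kappa>" using B Spawn(2-4) by auto
    show ?thesis
    proof (cases "?r = Ref x0 A B' \<or> ?r = Ref y0 B' B'")
      case True
      moreover have "A \<noteq> B'" using Spawn(3,4) by auto
      ultimately have "?a \<kappa>'" using Spawn(2) by auto
      then show ?thesis by (intro one) auto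
    next
      case False
      have "?n \<kappa>' \<longrightarrow> ?n \<kappa>" "\<And>y A. ?u \<kappa>' y A \<longrightarrow> ?u \<kappa> y A" "?a \<kappa> \<longrightarrow> ?a \<kappa>'" "?b \<kappa> \<longrightarrow> ?b \<kappa>'"
        using False Spawn(2) n k[OF Spawn(3)] by auto
      then show ?thesis using Spawn(2) B' by (intro keep) auto
    qed
  next
    case (Send A \<Phi> x0 B' ys n zs Cs)
    show ?thesis
    proof (cases "?r \<in> refobs B' zs Cs")
      case True
      then have "?c \<kappa>' > 0" using Send(2) by (auto simp: refobs_mem)
      then show ?thesis by (intro one) auto
    next
      case False
      then have "?u \<kappa>' y C \<longrightarrow> ?u \<kappa> y C" for y C
        using Send(2,6) k[OF Send(3)] by (auto simp: refobs_mem)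
      then show ?thesis using Send(2) k[OF Send(3)] B Send(3) by (intro keep) auto
    qed
  next
    case (Receive B' \<Phi> s R)
    show ?thesis
    proof (cases "D = B' \<and> ?r \<in> R")
      case True
      then have "?a \<kappa>'" using Receive(2) by auto
      then show ?thesis by (intro one) auto
    next
      case False
      then have "?c \<kappa>' = ?c \<kappa>" "?d \<kappa>' = ?d \<kappa>"
        using Receive(2) cnt_minus[OF Receive(4), of "carries ?r"]
          cnt_minus[OF Receive(4), of "releases ?r"] by auto
      then show ?thesis using Receive(2) k[OF Receive(3)] B Receive(3) by (intro keep) (auto simp: cnt_minus_le)
    qed
  next
    case (SendRelease A \<Phi> x0 B' n)
    show ?thesis
    proof (cases "?r = Ref x0 A B'")
      case True
      then have "?d \<kappa>' > 0" using SendRelease(2) by auto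
      then show ?thesis by (intro one) auto
    next
      case False
      then show ?thesis using SendRelease(2) k[OF SendRelease(3)] B SendRelease(3) by (intro keep) auto
    qed
  next
    case (Release B' \<Phi> x0 A n)
    show ?thesis
    proof (cases "?r = Ref x0 A B'")
      case True
      then have "?b \<kappa>'" using Release(2) by auto
      then show ?thesis by (intro one) auto
    next
      case False
      then have "?c \<kappa>' = ?c \<kappa>" "?d \<kappa>' = ?d \<kappa>"
        using Release(2) cnt_minus[OF Release(4), of "carries ?r"]
          cnt_minus[OF Release(4), of "releases ?r"] by auto
      then show ?thesis using Release(2) k[OF Release(3)] B Release(3) by (intro keep) (auto simp: cnt_minus_le)
    qed
  next
    case (Info C \<Phi> y A z B')
    have cd: "?c \<kappa>' = ?c \<kappa>" "?d \<kappa>' = ?d \<kappa>"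
      using Info(2) cnt_minus[OF Info(4), of "carries ?r"]
        cnt_minus[OF Info(4), of "releases ?r"] by auto
    have ab: "?a \<kappa> \<longrightarrow> ?a \<kappa>'" "?b \<kappa> \<longrightarrow> ?b \<kappa>'"
      using Info(2) k[OF Info(3)] by auto
    show ?thesis
    proof (cases "?r = Ref z B' C")
      case True
      then have "?i \<kappa> \<noteq> 0" using Info(4) by (auto simp: cnt_eq_0_iff)
      then have "announced \<kappa> ?r \<noteq> 0" unfolding an by simp
      moreover have "B \<in> dom (actors \<kappa>)" using B Info(2,3) by auto
      ultimately have "stage \<kappa> ?r \<noteq> 0" using old by fastforce
      moreover have "stage \<kappa> ?r \<le> stage \<kappa>' ?r" using ab cd by (intro keep_st) auto
      ultimately show ?thesis using ann' by linarith
    next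
      case False
      then show ?thesis
        using Info(2) k[OF Info(3)] B Info(3) ab cd by (intro keep) (auto simp: cnt_minus_le)
    qed
  next
    case (SendInfo A \<Phi> y0 C z0 B')
    have cd: "?c \<kappa>' = ?c \<kappa>" "?d \<kappa>' = ?d \<kappa>"
      using SendInfo(2) by auto
    have ab: "?a \<kappa> \<longrightarrow> ?a \<kappa>'" "?b \<kappa> \<longrightarrow> ?b \<kappa>'"
      using SendInfo(2) k[OF SendInfo(3)] by auto
    show ?thesis
    proof (cases "?r = Ref z0 B' C")
      case True
      then have "?u \<kappa> (Ref y0 A C) A" using SendInfo(4) k[OF SendInfo(3)] by simp
      then have "announced \<kappa> ?r \<noteq> 0" unfolding an by auto
      moreover have "B \<in> dom (actors \<kappa>)" using B SendInfo(2,3) by auto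
      ultimately have "stage \<kappa> ?r \<noteq> 0" using old by fastforce
      moreover have "stage \<kappa> ?r \<le> stage \<kappa>' ?r" using ab cd by (intro keep_st) auto
      ultimately show ?thesis using ann' by linarith
    next
      case False
      then show ?thesis
        using SendInfo(2) k[OF SendInfo(3)] B SendInfo(3) ab cd by (intro keep) auto
    qed
  next
    case (Compaction C \<Phi> x0 B')
    have i: "?i \<kappa>' = ?i \<kappa>" using Compaction(2) by simp
    have u: "?u \<kappa>' y A \<longrightarrow> ?u \<kappa> y A" for y A using Compaction(2) k[OF Compaction(3)] by auto
    show ?thesis
    proof (cases "?r = Ref x0 B' C")
      case True
      \<comment> \<open>The \<open>Created\<close> fact exhausts the bound of one, so no
        \<open>info\<close> message and no \<open>CreatedUsing\<close> fact remains after its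
        removal.\<close>
      have "?n \<kappa>" using True Compaction(4) k[OF Compaction(3)] by simp
      moreover have "\<not> ?n \<kappa>'" using True Compaction(2) by auto
      ultimately show ?thesis using ann i u unfolding an by auto
    next
      case False
      then show ?thesis using Compaction(2) k[OF Compaction(3)] B Compaction(3) by (intro keep) auto
    qed
  next
    case (In A Cs zs)
    then show ?thesis using B by (intro keep) auto
  next
    case (Out B' s R)
    \<comment> \<open>Otherwise \<open>Out\<close> would have made \<open>B\<close> a
      receptionist.\<close>
    have "\<not> (D = B' \<and> ?r \<in> R)" using Out(2) B by auto
    then have "?c \<kappa>' = ?c \<kappa>" "?d \<kappa>' = ?d \<kappa>"
      using Out(2) cnt_minus[OF Out(4), of "carries ?r"]
        cnt_minus[OF Out(4), of "releases ?r"] by auto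
    then show ?thesis using Out(2) B by (intro keep) (auto simp: cnt_minus_le)
  next
    case (ReleaseOut B' s n)
    have "B \<noteq> B'" using B ReleaseOut(2,3) wf_configD(2)[OF wf] by auto
    then have "?c \<kappa>' = ?c \<kappa>" "?d \<kappa>' = ?d \<kappa>"
      using ReleaseOut(2) cnt_minus[OF ReleaseOut(4), of "carries ?r"] by auto
    then show ?thesis using ReleaseOut(2) B by (intro keep) (auto simp: cnt_minus_le)
  next
    case (InfoOut B' y z D')
    have "?c \<kappa>' = ?c \<kappa>" "?d \<kappa>' = ?d \<kappa>"
      using InfoOut(2) cnt_minus[OF InfoOut(4), of "carries ?r"]
        cnt_minus[OF InfoOut(4), of "releases ?r"] by auto
    then show ?thesis using InfoOut(2) B by (intro keep) (auto simp: cnt_minus_le)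
  next
    case (Idle A \<Phi>)
    then show ?thesis using k[OF Idle(3)] B Idle(3) by (intro keep) auto
  next
    case (Snapshot A \<Phi>)
    then show ?thesis using B by (intro keep) auto
  qed
qed

text \<open>\<open>Send\<close> and \<open>SendInfo\<close> raise the send count together with the
  messages in transit; \<open>Receive\<close> and \<open>Info\<close> move one unit from transit to
  the receive count. \<open>SendRelease\<close> records a count that is final: a refob in the
  release stage is no longer active, so nothing more is sent along it.\<close>

lemma balanced_step:
  fixes \<kappa> :: "('a, 't) config"
  assumes wf: "wf_config \<kappa>" and life: "life_cycle \<kappa>" and bal: "balanced \<kappa>"
    and step: "step \<kappa> e \<kappa>'"
  shows "balanced \<kappa>'"
  unfolding balanced_def
proof (intro allI impI)
  fix x :: 't and D B
  assume B: "B \<in> dom (actors \<kappa>')"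
  let ?r = "Ref x D B"
  let ?c = "\<lambda>\<kappa>. cnt (carries ?r) (msgs \<kappa> D)"
    and ?a = "\<lambda>\<kappa>. Activated ?r \<in> known \<kappa> D"
    and ?d = "\<lambda>\<kappa>. cnt (releases ?r) (msgs \<kappa> B)"
    and ?b = "\<lambda>\<kappa>. Released ?r \<in> known \<kappa> B"
    and ?s = "\<lambda>\<kappa>. sent (known \<kappa> D) ?r"
    and ?m = "\<lambda>\<kappa> n. release ?r n \<in># msgs \<kappa> B"
    and ?t = "\<lambda>\<kappa>. recv (known \<kappa> B) ?r"
    and ?l = "\<lambda>\<kappa>. cnt (sent_along ?r) (msgs \<kappa> B)"
  let ?F = "\<lambda>\<kappa>. (?a \<kappa> \<or> ?c \<kappa> > 0 \<longrightarrow> ?s \<kappa> = arrivals \<kappa> ?r) \<and> (\<forall>n. ?m \<kappa> n \<longrightarrow> n = arrivals \<kappa> ?r)"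
  have arr: "arrivals \<kappa> ?r = ?t \<kappa> + ?l \<kappa>" for \<kappa> :: "('a, 't) config"
    by (simp add: arrivals_def)
  have stage: "?c \<kappa> + of_bool (?a \<kappa>) + ?d \<kappa> + of_bool (?b \<kappa>) \<le> 1"
    using life unfolding life_cycle_def stage_def by simp
  have d0: "\<not> ?m \<kappa> n" if "?d \<kappa> = 0" for n and \<kappa> :: "('a, 't) config"
    using that by (auto simp: cnt_eq_0_iff)
  have F: "?F \<kappa>" if "B \<in> dom (actors \<kappa>) \<or> B \<notin> dom (actors \<kappa>) \<union> ext \<kappa>"
  proof (cases "B \<in> dom (actors \<kappa>)")
    case True
    then show ?thesis using bal unfolding balanced_def by blast
  next
    case False
    then have "x \<notin> used \<kappa> \<or> B \<notin> dom (actors \<kappa>) \<union> ext \<kappa>" using that by blast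
    note 0 = wf_config_absent[OF wf this, where D = D]
    show ?thesis using 0(1,5) d0[OF 0(6)] by simp
  qed
  have k: "known \<kappa> A = \<Phi>" if "actors \<kappa> A = Some (s, \<Phi>)" for A s \<Phi>
    by (rule known_Some[OF that])
  have sv: "single_valued_counts \<Phi>" if "actors \<kappa> A = Some (s, \<Phi>)" for A s \<Phi>
    using wf_configD(6)[OF wf, of A] known_Some[OF that] by simp
  have keep: "?F \<kappa>'"
    if "?a \<kappa>' \<longrightarrow> ?a \<kappa> \<or> ?c \<kappa> > 0" "?c \<kappa>' \<le> ?c \<kappa>" "\<And>n. ?m \<kappa>' n \<longrightarrow> ?m \<kappa> n"
      "?s \<kappa>' = ?s \<kappa>" "?t \<kappa>' + ?l \<kappa>' = ?t \<kappa> + ?l \<kappa>"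
      "B \<in> dom (actors \<kappa>) \<or> B \<notin> dom (actors \<kappa>) \<union> ext \<kappa>"
    using F[OF that(6)] that(1-5) unfolding arr by fastforce
  \<comment> \<open>A fresh token starts with send count and arrivals both zero.\<close>
  have fresh: "?F \<kappa>'"
    if x: "x \<notin> used \<kappa>" and "?s \<kappa>' = ?s \<kappa>" "?t \<kappa>' + ?l \<kappa>' = ?t \<kappa> + ?l \<kappa>"
      "\<And>n. ?m \<kappa>' n \<longrightarrow> ?m \<kappa> n"
  proof -
    have "x \<notin> used \<kappa> \<or> B \<notin> dom (actors \<kappa>) \<union> ext \<kappa>" using x by blast
    note 0 = wf_config_absent[OF wf this, where D = D]
    show ?thesis using that 0(8,9) d0[OF 0(6)] unfolding arr by simp
  qed
  show "?F \<kappa>'"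
    using step
  proof cases
    case (Spawn A \<Phi> B' x0 y0)
    have n: "known \<kappa> B' = {}" using known_None Spawn(4) by fast
    have B': "B \<in> dom (actors \<kappa>) \<or> B \<notin> dom (actors \<kappa>) \<union> ext \<kappa>" using B Spawn(2-4) by auto
    have s: "?s \<kappa>' = ?s \<kappa>" using Spawn(2) n k[OF Spawn(3)] by (intro sent_cong) auto
    have t: "?t \<kappa>' = ?t \<kappa>" using Spawn(2) n k[OF Spawn(3)] by (intro recv_cong) auto
    have m: "msgs \<kappa>' = msgs \<kappa>" using Spawn(2) by simp
    show ?thesis
    proof (cases "x = x0 \<or> x = y0")
      case True
      then have "x \<notin> used \<kappa>" using Spawn(5,6) by auto
      then show ?thesis using s t m by (intro fresh) simp_all
    next
      case False
      then have "?a \<kappa>' \<longrightarrow> ?a \<kappa>" using Spawn(2) n k[OF Spawn(3)] by auto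
      then show ?thesis using s t m B' by (intro keep) auto
    qed
  next
    case (Send A \<Phi> x0 B' ys n zs Cs)
    let ?new = "{CreatedUsing (Ref (ys ! i) A (Cs ! i)) (Ref (zs ! i) B' (Cs ! i)) | i. i < n}"
    have "sent (inc_sent (Ref x0 A B') \<Phi> \<union> ?new) ?r = sent (inc_sent (Ref x0 A B') \<Phi>) ?r"
      by (intro sent_cong) auto
    then have s: "?s \<kappa>' = ?s \<kappa> + of_bool (?r = Ref x0 A B')"
      using Send(2) k[OF Send(3)] by (auto simp: sent_inc_sent[OF sv[OF Send(3)]])
    have t: "?t \<kappa>' = ?t \<kappa>"
      using Send(2) k[OF Send(3)] by (intro recv_cong) auto
    have l: "?l \<kappa>' = ?l \<kappa> + of_bool (?r = Ref x0 A B')" using Send(2) by auto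
    have m: "?m \<kappa>' n \<longrightarrow> ?m \<kappa> n" for n using Send(2) by auto
    have a: "?a \<kappa>' \<longrightarrow> ?a \<kappa>" using Send(2) k[OF Send(3)] by auto
    have x0: "Activated (Ref x0 A B') \<in> known \<kappa> A" using Send(4) k[OF Send(3)] by simp
    have B': "B \<in> dom (actors \<kappa>)" using B Send(2,3) by auto
    show ?thesis
    proof (cases "?r = Ref x0 A B'")
      case True
      then have "?a \<kappa>" using x0 by simp
      \<comment> \<open>An active refob has no release message pending, because the stages exclude
        each other. So the arrivals grow only while no release message states a count for
        them.\<close>
      then have 0: "?d \<kappa> = 0" and bal0: "?s \<kappa> = ?t \<kappa> + ?l \<kappa>"
        using stage F B' unfolding arr by auto
      have "?s \<kappa>' = ?t \<kappa>' + ?l \<kappa>'" using s t l bal0 by simp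
      moreover have "\<not> ?m \<kappa>' n" for n using m[of n] d0[OF 0, of n] by blast
      ultimately show ?thesis unfolding arr by blast
    next
      case False
      show ?thesis
      proof (cases "x \<in> set zs")
        case True
        then have "x \<notin> used \<kappa>" using Send(10) by auto
        then show ?thesis using s t l m False by (intro fresh) auto
      next
        case notin: False
        then have "?r \<notin> refobs B' zs Cs" by (auto simp: refobs_mem)
        then have "?c \<kappa>' \<le> ?c \<kappa>" using Send(2) by auto
        then show ?thesis using s t l m a B' False by (intro keep) auto
      qed
    qed
  next
    case (Receive B' \<Phi> q R)
    have "sent (inc_recv q \<Phi> \<union> Activated ` R) ?r = sent (inc_recv q \<Phi>) ?r"
      by (intro sent_cong) auto
    then have s: "?s \<kappa>' = ?s \<kappa>" using Receive(2) k[OF Receive(3)] by auto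
    have "recv (inc_recv q \<Phi> \<union> Activated ` R) ?r = recv (inc_recv q \<Phi>) ?r"
      by (intro recv_cong) auto
    then have "recv (inc_recv q \<Phi> \<union> Activated ` R) ?r = recv \<Phi> ?r + of_bool (q = ?r)"
      by (simp add: recv_inc_recv[OF sv[OF Receive(3)]] eq_commute[of q])
    then have "?t \<kappa>' + ?l \<kappa>' = ?t \<kappa> + ?l \<kappa>" if "B = B'"
      using that Receive(2) k[OF Receive(3)] cnt_minus[OF Receive(4), of "sent_along ?r"] by simp
    moreover have "?t \<kappa>' + ?l \<kappa>' = ?t \<kappa> + ?l \<kappa>" if "B \<noteq> B'"
      using that Receive(2) by simp
    ultimately have tl: "?t \<kappa>' + ?l \<kappa>' = ?t \<kappa> + ?l \<kappa>" by blast
    have m: "?m \<kappa>' n \<longrightarrow> ?m \<kappa> n" for n using Receive(2) by (auto dest: in_diffD)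
    have a: "?a \<kappa>' \<longrightarrow> ?a \<kappa> \<or> ?c \<kappa> > 0"
    proof (cases "D = B' \<and> ?r \<in> R")
      case True
      then show ?thesis using Receive(2) cnt_minus[OF Receive(4), of "carries ?r"] by auto
    next
      case False
      then show ?thesis using Receive(2) k[OF Receive(3)] by auto
    qed
    have c: "?c \<kappa>' \<le> ?c \<kappa>" using Receive(2) by (auto simp: cnt_minus_le)
    have "B \<in> dom (actors \<kappa>)" using B Receive(2,3) by auto
    then show ?thesis using s tl m a c by (intro keep) auto
  next
    case (SendInfo A \<Phi> y0 C z0 B')
    let ?q = "Ref y0 A C" and ?\<Psi> = "\<Phi> - {CreatedUsing (Ref y0 A C) (Ref z0 B' C)}"
    have sv': "single_valued_counts ?\<Psi>"
      by (rule single_valued_counts_subset[OF sv[OF SendInfo(3)]]) auto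
    have "sent ?\<Psi> ?r = sent \<Phi> ?r" by (rule sent_cong) simp
    then have s: "?s \<kappa>' = ?s \<kappa> + of_bool (?r = ?q)"
      using SendInfo(2) k[OF SendInfo(3)] by (auto simp: sent_inc_sent[OF sv'])
    have t: "?t \<kappa>' = ?t \<kappa>"
      using SendInfo(2) k[OF SendInfo(3)] by (intro recv_cong) auto
    have l: "?l \<kappa>' = ?l \<kappa> + of_bool (?r = ?q)" using SendInfo(2) by auto
    have m: "?m \<kappa>' n \<longrightarrow> ?m \<kappa> n" for n using SendInfo(2) by auto
    have a: "?a \<kappa>' \<longrightarrow> ?a \<kappa>" using SendInfo(2) k[OF SendInfo(3)] by auto
    have c: "?c \<kappa>' \<le> ?c \<kappa>" using SendInfo(2) by auto
    have B': "B \<in> dom (actors \<kappa>)" using B SendInfo(2,3) by auto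
    show ?thesis
    proof (cases "?r = ?q")
      case True
      \<comment> \<open>\<open>SendInfo\<close> tests only for the \<open>CreatedUsing\<close> fact;
        that the refob used for sending is active comes from well-formedness.\<close>
      then have "?a \<kappa>" using wf_configD(7)[OF wf] SendInfo(4) k[OF SendInfo(3)] by auto
      then have 0: "?d \<kappa> = 0" and bal0: "?s \<kappa> = ?t \<kappa> + ?l \<kappa>"
        using stage F B' unfolding arr by auto
      have "?s \<kappa>' = ?t \<kappa>' + ?l \<kappa>'" using s t l bal0 by simp
      moreover have "\<not> ?m \<kappa>' n" for n using m[of n] d0[OF 0, of n] by blast
      ultimately show ?thesis unfolding arr by blast
    next
      case False
      then show ?thesis using s t l m a c B' by (intro keep) auto
    qed
  next
    case (Info C \<Phi> y A z B')
    let ?q = "Ref y A C"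
    have "sent (inc_recv ?q \<Phi> \<union> {Created (Ref z B' C)}) ?r = sent (inc_recv ?q \<Phi>) ?r"
      by (intro sent_cong) auto
    then have s: "?s \<kappa>' = ?s \<kappa>" using Info(2) k[OF Info(3)] by auto
    have "recv (inc_recv ?q \<Phi> \<union> {Created (Ref z B' C)}) ?r = recv (inc_recv ?q \<Phi>) ?r"
      by (intro recv_cong) auto
    then have t: "?t \<kappa>' = ?t \<kappa> + of_bool (?q = ?r)"
      using Info(2) k[OF Info(3)] by (auto simp: recv_inc_recv[OF sv[OF Info(3)]])
    have l: "?l \<kappa>' + of_bool (?q = ?r) = ?l \<kappa>"
      using Info(2) cnt_minus[OF Info(4), of "sent_along ?r"] by auto
    have m: "?m \<kappa>' n \<longrightarrow> ?m \<kappa> n" for n using Info(2) by (auto dest: in_diffD)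
    have a: "?a \<kappa>' \<longrightarrow> ?a \<kappa>" using Info(2) k[OF Info(3)] by auto
    have c: "?c \<kappa>' \<le> ?c \<kappa>" using Info(2) by (auto simp: cnt_minus_le)
    have "B \<in> dom (actors \<kappa>)" using B Info(2,3) by auto
    then show ?thesis using s t l m a c by (intro keep) auto
  next
    case (SendRelease A \<Phi> x0 B' n0)
    have B': "B \<in> dom (actors \<kappa>)" using B SendRelease(2,3) by auto
    have t: "?t \<kappa>' = ?t \<kappa>"
      using SendRelease(2) k[OF SendRelease(3)] by (intro recv_cong) auto
    have l: "?l \<kappa>' = ?l \<kappa>" and c: "?c \<kappa>' = ?c \<kappa>"
      and m: "?m \<kappa>' n \<longrightarrow> ?m \<kappa> n \<or> ?r = Ref x0 A B' \<and> n = n0" for n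
      using SendRelease(2) by auto
    show ?thesis
    proof (cases "?r = Ref x0 A B'")
      case True
      then have a: "?a \<kappa>" "\<not> ?a \<kappa>'"
        using SendRelease(2,4) k[OF SendRelease(3)] by auto
      then have 0: "?d \<kappa> = 0" "?c \<kappa> = 0" "?s \<kappa> = ?t \<kappa> + ?l \<kappa>"
        using stage F B' unfolding arr by auto
      \<comment> \<open>The rule lets the sender announce only a derivable count, and the send count
        is the only one.\<close>
      have "n0 = ?s \<kappa>"
        using True SendRelease(5) k[OF SendRelease(3)] sent_iff[OF sv[OF SendRelease(3)]] by auto
      then have "n = ?t \<kappa>' + ?l \<kappa>'" if "?m \<kappa>' n" for n
        using that m[of n] d0[OF 0(1), of n] 0(3) t l by simp
      then show ?thesis using a(2) c 0(2) unfolding arr by simp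
    next
      case False
      then have "?s \<kappa>' = ?s \<kappa>"
        using SendRelease(2) k[OF SendRelease(3)] by (intro sent_cong) auto
      moreover have "?a \<kappa>' \<longrightarrow> ?a \<kappa>" using SendRelease(2) k[OF SendRelease(3)] by auto
      ultimately show ?thesis using t l c m False B' by (intro keep) auto
    qed
  next
    case (Release B' \<Phi> x0 A n)
    have s: "?s \<kappa>' = ?s \<kappa>" using Release(2) k[OF Release(3)] by (intro sent_cong) auto
    have t: "?t \<kappa>' = ?t \<kappa>" using Release(2) k[OF Release(3)] by (intro recv_cong) auto
    have l: "?l \<kappa>' = ?l \<kappa>"
      using Release(2) cnt_minus[OF Release(4), of "sent_along ?r"] by auto
    have m: "?m \<kappa>' n \<longrightarrow> ?m \<kappa> n" for n using Release(2) by (auto dest: in_diffD)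
    have a: "?a \<kappa>' \<longrightarrow> ?a \<kappa>" using Release(2) k[OF Release(3)] by auto
    have c: "?c \<kappa>' \<le> ?c \<kappa>" using Release(2) by (auto simp: cnt_minus_le)
    have "B \<in> dom (actors \<kappa>)" using B Release(2,3) by auto
    then show ?thesis using s t l m a c by (intro keep) auto
  next
    case (Compaction C \<Phi> x0 B')
    have a: "?a \<kappa>' \<longrightarrow> ?a \<kappa>" using Compaction(2) k[OF Compaction(3)] by auto
    have m: "msgs \<kappa>' = msgs \<kappa>" using Compaction(2) by simp
    show ?thesis
    proof (cases "?r = Ref x0 B' C")
      case True
      \<comment> \<open>A released refob is neither carried nor active nor named in a release
        message, so forgetting its receive count violates nothing.\<close>
      then have "?b \<kappa>" using Compaction(5) k[OF Compaction(3)] by simp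
      then have "\<not> ?a \<kappa>" "?c \<kappa> = 0" "?d \<kappa> = 0" using stage by auto
      then show ?thesis using a m d0[of \<kappa>] by simp
    next
      case False
      have "?s \<kappa>' = ?s \<kappa>"
        using Compaction(2) k[OF Compaction(3)] by (intro sent_cong) auto
      moreover have "?t \<kappa>' = ?t \<kappa>"
        using Compaction(2) k[OF Compaction(3)] False by (intro recv_cong) auto
      moreover have "B \<in> dom (actors \<kappa>)" using B Compaction(2,3) by auto
      ultimately show ?thesis using a m by (intro keep) auto
    qed
  next
    case (In A Cs zs)
    have kn: "known \<kappa>' = known \<kappa>" and l: "?l \<kappa>' = ?l \<kappa>" and m: "?m \<kappa>' n \<longrightarrow> ?m \<kappa> n" for n
      using In(2) by auto
    show ?thesis
    proof (cases "x \<in> set zs")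
      case True
      then have "x \<notin> used \<kappa>" using In by auto
      then show ?thesis using kn l m by (intro fresh) auto
    next
      case False
      then have "?r \<notin> refobs A zs Cs" using In by (auto simp: refobs_mem)
      then have "?c \<kappa>' \<le> ?c \<kappa>" using In(2) by auto
      then show ?thesis using kn l m B In(2) by (intro keep) auto
    qed
  next
    case (Out B' q R)
    have "B \<noteq> B'" using B Out(2,3) wf_configD(2)[OF wf] by auto
    then show ?thesis using Out(2) B by (intro keep) (auto simp: cnt_minus_le)
  next
    case (ReleaseOut B' s n)
    have "B \<noteq> B'" using B ReleaseOut(2,3) wf_configD(2)[OF wf] by auto
    then show ?thesis using ReleaseOut(2) B by (intro keep) (auto simp: cnt_minus_le)
  next
    case (InfoOut B' y z D')
    have "B \<noteq> B'" using B InfoOut(2,3) wf_configD(2)[OF wf] by auto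
    then show ?thesis using InfoOut(2) B by (intro keep) (auto simp: cnt_minus_le)
  next
    case (Idle A \<Phi>)
    then show ?thesis using k[OF Idle(3)] B Idle(3) by (intro keep) auto
  next
    case (Snapshot A \<Phi>)
    then show ?thesis using B by (intro keep) auto
  qed
qed

definition invariant :: "('a, 't) config \<Rightarrow> bool" where
  "invariant \<kappa> \<longleftrightarrow> wf_config \<kappa> \<and> life_cycle \<kappa> \<and> balanced \<kappa>"

text \<open>There are no messages and no counts yet, and the only announced refob leads from the
  initial actor to itself and is active.\<close>

lemma invariant_initial:
  assumes "initial \<kappa>"
  shows "invariant \<kappa>"
proof -
  obtain A E x y where ne: "A \<noteq> E" "x \<noteq> y" and \<kappa>: "\<kappa> = \<lparr>actors = [A \<mapsto> (busy, {Activated (Ref x A E),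
      Created (Ref y A A), Activated (Ref y A A)})],
      msgs = (\<lambda>_. {#}), recept = {}, ext = {E}, used = {x, y}\<rparr>"
    using assms unfolding initial_def by blast
  have m: "msgs \<kappa> B = {#}" and d: "dom (actors \<kappa>) = {A}" for B by (simp_all add: \<kappa>)
  have kn: "known \<kappa> = (\<lambda>_. {})(A := {Activated (Ref x A E), Created (Ref y A A), Activated (Ref y A A)})"
    by (auto simp: known_def \<kappa> fun_eq_iff)
  have "stage \<kappa> (Ref z D B) = of_bool (Activated (Ref z D B) \<in> known \<kappa> D)" for z D B
    by (simp add: stage_def m kn)
  moreover have "announced \<kappa> (Ref z D B) = of_bool (Created (Ref z D B) \<in> known \<kappa> B)" for z D B
    by (simp add: announced_def m kn)
  moreover have "Activated (Ref z D B) \<in> known \<kappa> D" if "Created (Ref z D B) \<in> known \<kappa> B" for z D B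
    using that by (auto simp: kn split: if_splits)
  moreover have "CreatedUsing w r \<notin> known \<kappa> B" for w r B
    by (simp add: kn)
  ultimately have "life_cycle \<kappa>"
    unfolding life_cycle_def by simp
  moreover have "balanced \<kappa>"
    by (simp add: balanced_def arrivals_def m kn sent_eq_0 recv_eq_0)
  ultimately show ?thesis
    using wf_config_initial[OF assms] by (simp add: invariant_def)
qed

lemma life_cycle_step:
  assumes wf: "wf_config \<kappa>" and life: "life_cycle \<kappa>" and step: "step \<kappa> e \<kappa>'"
  shows "life_cycle \<kappa>'"
proof -
  have "stage \<kappa>' (Ref x D B) \<le> 1" for x D B
    using life unfolding life_cycle_def by (intro stage_step[OF wf _ step]) blast
  then show ?thesis
    unfolding life_cycle_def
    using announced_step[OF wf life step] announced_le_stage_step[OF wf life step] by blast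
qed

lemma invariant_step:
  assumes "invariant \<kappa>" and "step \<kappa> e \<kappa>'"
  shows "invariant \<kappa>'"
  using assms wf_config_step life_cycle_step balanced_step unfolding invariant_def by blast

section \<open>Dead actors\<close>

lemma reachable_refl: "reachable \<kappa> \<kappa>"
  by (simp add: reachable_def)

lemma reachable_snoc: "reachable \<kappa> \<kappa>' \<Longrightarrow> step \<kappa>' e \<kappa>'' \<Longrightarrow> reachable \<kappa> \<kappa>''"
  unfolding reachable_def
  by (rule rtranclp.rtrancl_into_rtrancl[where r = "\<lambda>\<kappa> \<kappa>'. \<exists>e. step \<kappa> e \<kappa>'"]) auto

lemma reachable_trans: "reachable \<kappa> \<kappa>' \<Longrightarrow> reachable \<kappa>' \<kappa>'' \<Longrightarrow> reachable \<kappa> \<kappa>''"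
  unfolding reachable_def by (rule rtranclp_trans)

lemma reachable_step: "step \<kappa> e \<kappa>' \<Longrightarrow> reachable \<kappa> \<kappa>'"
  by (rule reachable_snoc[OF reachable_refl])

lemma reachable_induct [consumes 1, case_names refl step]:
  assumes "reachable \<kappa> \<kappa>'" and "P \<kappa>"
    and "\<And>\<kappa>' e \<kappa>''. reachable \<kappa> \<kappa>' \<Longrightarrow> P \<kappa>' \<Longrightarrow> step \<kappa>' e \<kappa>'' \<Longrightarrow> P \<kappa>''"
  shows "P \<kappa>'"
  using assms(1) unfolding reachable_def
  by (induction rule: rtranclp_induct) (use assms(2,3) in \<open>auto simp: reachable_def\<close>)

lemma invariant_reachable: "reachable \<kappa> \<kappa>' \<Longrightarrow> invariant \<kappa> \<Longrightarrow> invariant \<kappa>'"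
  by (induction rule: reachable_induct) (auto intro: invariant_step)

definition dead :: "('a, 't) config \<Rightarrow> 'a \<Rightarrow> bool" where
  "dead \<kappa> B \<longleftrightarrow> B \<in> dom (actors \<kappa>) \<and>
     (\<forall>\<kappa>' \<Phi>. reachable \<kappa> \<kappa>' \<longrightarrow> actors \<kappa>' B \<noteq> Some (busy, \<Phi>))"

lemma dead_idle:
  assumes "dead \<kappa> B" obtains \<Phi> where "actors \<kappa> B = Some (idle, \<Phi>)"
proof -
  obtain s \<Phi> where "actors \<kappa> B = Some (s, \<Phi>)" using assms by (auto simp: dead_def)
  then show ?thesis using assms reachable_refl that by (cases s) (auto simp: dead_def)
qed

lemma dead_step: "dead \<kappa> B \<Longrightarrow> step \<kappa> e \<kappa>' \<Longrightarrow> dead \<kappa>' B"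
  unfolding dead_def using step_mono reachable_trans[OF reachable_step] by blast

lemma dead_reachable: "reachable \<kappa> \<kappa>' \<Longrightarrow> dead \<kappa> B \<Longrightarrow> dead \<kappa>' B"
  by (induction rule: reachable_induct) (auto intro: dead_step)

lemma step_busy:
  assumes "step \<kappa> e \<kappa>'" and "actors \<kappa> A = Some (idle, \<Phi>)" and "actors \<kappa>' A = Some (busy, \<Psi>)"
  shows "msgs \<kappa> A \<noteq> {#}"
  using assms by cases (auto split: if_splits)

text \<open>An idle actor becomes busy only by consuming a message, and none ever arrives.\<close>

lemma terminated_dead:
  assumes "terminated \<kappa> A"
  shows "dead \<kappa> A"
proof -
  obtain \<Phi> where idle: "actors \<kappa> A = Some (idle, \<Phi>)"
    and empty: "\<And>\<kappa>'. reachable \<kappa> \<kappa>' \<Longrightarrow> msgs \<kappa>' A = {#}"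
    using assms unfolding terminated_def by blast
  have "\<exists>\<Phi>. actors \<kappa>' A = Some (idle, \<Phi>)" if "reachable \<kappa> \<kappa>'" for \<kappa>'
    using that
  proof (induction rule: reachable_induct)
    case refl
    then show ?case using idle by blast
  next
    case (step \<kappa>' e \<kappa>'')
    then obtain \<Psi> where \<Psi>: "actors \<kappa>' A = Some (idle, \<Psi>)" by blast
    have "A \<in> dom (actors \<kappa>'')" using \<Psi> step_mono[OF step(2)] by blast
    then obtain s \<Psi>' where s: "actors \<kappa>'' A = Some (s, \<Psi>')" by auto
    moreover have "s \<noteq> busy" using step_busy[OF step(2) \<Psi>] s empty[OF step(1)] by auto
    ultimately show ?case by (cases s) auto
  qed
  then show ?thesis unfolding dead_def using idle by fastforce
qed

lemma dead_no_app:
  assumes "dead \<kappa> B"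
  shows "app r R \<notin># msgs \<kappa> B"
proof
  assume m: "app r R \<in># msgs \<kappa> B"
  obtain \<Phi> where "actors \<kappa> B = Some (idle, \<Phi>)" using assms by (rule dead_idle)
  note r = reachable_step[OF step.Receive[OF this m]]
  then show False using assms unfolding dead_def by fastforce
qed

lemma dead_reachable_no_app: "dead \<kappa> B \<Longrightarrow> reachable \<kappa> \<kappa>' \<Longrightarrow> app r R \<notin># msgs \<kappa>' B"
  by (rule dead_no_app[OF dead_reachable])

text \<open>The environment can send a receptionist an \<open>app\<close> message that carries no
  refobs, so that the side conditions of \<open>In\<close> hold trivially.\<close>

lemma dead_not_recept:
  assumes "dead \<kappa> B"
  shows "B \<notin> recept \<kappa>"
proof
  assume "B \<in> recept \<kappa>"
  then have "step \<kappa> (In B (refobs B [] [])) (use_tokens (set [])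
      (post B (app Bot (refobs B [] [])) (\<kappa>\<lparr>ext := ext \<kappa> \<union> (set [] - dom (actors \<kappa>))\<rparr>)))"
    by (intro step.In) auto
  from dead_reachable_no_app[OF assms reachable_step[OF this]] show False by auto
qed

text \<open>A busy actor can at once send an empty message along any refob that it holds.\<close>

lemma busy_holder_not_dead:
  assumes "actors \<kappa> D = Some (busy, \<Phi>)" and "Activated (Ref x D B) \<in> \<Phi>"
  shows "\<not> dead \<kappa> B"
proof
  assume dead: "dead \<kappa> B"
  have "\<Phi> \<turnstile> Activated (Ref x D B)" using assms(2) by simp
  note send = step.Send[OF assms(1) this, where n = 0 and ys = "[]" and zs = "[]" and Cs = "[]", simplified]
  show False using dead_reachable_no_app[OF dead reachable_step[OF send]] by auto
qed

text \<open>Only \<open>SendRelease\<close> gives up an active refob, and it is performed by a busy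
  owner. \<open>Spawn\<close> overwrites the knowledge of its new actor only, which was
  empty.\<close>

lemma Activated_step:
  assumes "step \<kappa> e \<kappa>'" and "Activated r \<in> known \<kappa> D"
  shows "Activated r \<in> known \<kappa>' D \<or> (\<exists>\<Phi>. actors \<kappa> D = Some (busy, \<Phi>))"
  using assms(1)
proof cases
  case (Spawn A \<Phi> B x y)
  have "D \<noteq> B" using Spawn(4) assms(2) known_None[of B \<kappa>] by auto
  then show ?thesis using Spawn(2,3) assms(2) by (auto simp: known_Some)
qed (use assms(2) in \<open>auto simp: known_Some\<close>)

text \<open>To drop the refob the owner has to be busy, but a busy owner that still has it could
  send along it. So the refob is kept in all reachable configurations, and the owner is busy in none
  of them.\<close>

lemma holder_of_dead:
  assumes dead: "dead \<kappa> B" and act: "Activated (Ref x D B) \<in> known \<kappa> D"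
  shows "dead \<kappa> D"
  unfolding dead_def
proof (intro conjI allI impI notI)
  show "D \<in> dom (actors \<kappa>)" using act known_None by fastforce
  have safe: False if "reachable \<kappa> \<kappa>'" "actors \<kappa>' D = Some (busy, \<Phi>)" "Activated (Ref x D B) \<in> known \<kappa>' D"
    for \<kappa>' \<Phi>
    using busy_holder_not_dead that dead_reachable[OF that(1) dead] known_Some by metis
  have keep: "Activated (Ref x D B) \<in> known \<kappa>' D" if "reachable \<kappa> \<kappa>'" for \<kappa>'
    using that
  proof (induction rule: reachable_induct)
    case refl
    then show ?case by (rule act)
  next
    case (step \<kappa>' e \<kappa>'')
    show ?case using Activated_step[OF step(2,3)] safe[OF step(1) _ step(3)] by blast
  qed
  show False if "reachable \<kappa> \<kappa>'" "actors \<kappa>' D = Some (busy, \<Phi>)" for \<kappa>' \<Phi>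
    using safe keep that by blast
qed

text \<open>An internal recipient can accept the message and is then a busy holder of the refob. An
  external one can accept it as well, which makes \<open>B\<close> a receptionist. Both contradict
  deadness.\<close>

lemma dead_not_pending:
  assumes inv: "invariant \<kappa>" and dead: "dead \<kappa> B" and m: "app r R \<in># msgs \<kappa> D"
  shows "Ref x D B \<notin> R"
proof
  assume R: "Ref x D B \<in> R"
  have wf: "wf_config \<kappa>" using inv by (simp add: invariant_def)
  have "D \<in> dom (actors \<kappa>) \<union> ext \<kappa>" using wf_configD(5)[OF wf m] by simp
  moreover have False if D: "D \<in> dom (actors \<kappa>)"
  proof -
    obtain s \<Phi> where s: "actors \<kappa> D = Some (s, \<Phi>)" using D by auto
    \<comment> \<open>\<open>Receive\<close> needs an idle actor, so a busy recipient performs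
      \<open>Idle\<close> before it.\<close>
    have "\<exists>\<kappa>' \<Phi>. reachable \<kappa> \<kappa>' \<and> actors \<kappa>' D = Some (idle, \<Phi>) \<and> app r R \<in># msgs \<kappa>' D"
    proof (cases s)
      case busy
      then have "step \<kappa> (Idle D) (set_actor D idle \<Phi> \<kappa>)" using s by (auto intro: step.Idle)
      from reachable_step[OF this] show ?thesis using m by fastforce
    next
      case idle
      then show ?thesis using s m reachable_refl by blast
    qed
    then obtain \<kappa>' \<Phi>' where *: "reachable \<kappa> \<kappa>'" "actors \<kappa>' D = Some (idle, \<Phi>')" "app r R \<in># msgs \<kappa>' D"
      by blast
    let ?\<kappa> = "consume D (app r R) (set_actor D busy (inc_recv r \<Phi>' \<union> Activated ` R) \<kappa>')"
    have "dead ?\<kappa> B"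
      using dead_step[OF dead_reachable[OF *(1) dead] step.Receive[OF *(2,3)]] .
    moreover have "actors ?\<kappa> D = Some (busy, inc_recv r \<Phi>' \<union> Activated ` R)" by simp
    moreover have "Activated (Ref x D B) \<in> inc_recv r \<Phi>' \<union> Activated ` R" using R by simp
    ultimately show False using busy_holder_not_dead by metis
  qed
  moreover have False if D: "D \<in> ext \<kappa>"
  proof -
    let ?\<kappa> = "consume D (app r R) (\<kappa>\<lparr>recept := recept \<kappa> \<union> {C \<in> dom (actors \<kappa>). \<exists>z D. Ref z D C \<in> R}\<rparr>)"
    have "B \<in> dom (actors \<kappa>)" using dead by (simp add: dead_def)
    then have "B \<in> recept ?\<kappa>" using R by auto
    moreover have "B \<notin> recept ?\<kappa>"
      by (rule dead_not_recept[OF dead_step[OF dead step.Out[OF D m]]])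
    ultimately show False by contradiction
  qed
  ultimately show False by blast
qed

text \<open>Refobs become active by \<open>Spawn\<close>, whose targets were no actors before, or by
  \<open>Receive\<close>, where none to a dead actor is pending. This traces owners found late in
  the execution back to the moment at which the set S is fixed.\<close>

lemma holder_of_dead_step:
  assumes inv: "invariant \<kappa>" and step: "step \<kappa> e \<kappa>'" and dead: "dead \<kappa> B"
    and act: "Activated (Ref x D B) \<in> known \<kappa>' D"
  shows "Activated (Ref x D B) \<in> known \<kappa> D"
  using step
proof cases
  case (Spawn A \<Phi> B' x0 y0)
  have "B \<noteq> B'" using Spawn(4) dead by (auto simp: dead_def)
  then show ?thesis using Spawn(2,3) act by (auto simp: known_Some split: if_splits)
next
  case (Receive B' \<Phi> r R)
  then show ?thesis
    using act dead_not_pending[OF inv dead Receive(4)] by (auto simp: known_Some split: if_splits)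
qed (use act in \<open>auto simp: known_Some split: if_splits\<close>)

text \<open>Messages are posted by a busy holder of a refob to the recipient, or by the environment
  to a receptionist.\<close>

lemma dead_msgs_step:
  assumes inv: "invariant \<kappa>" and step: "step \<kappa> e \<kappa>'" and dead: "dead \<kappa> B"
  shows "msgs \<kappa>' B \<subseteq># msgs \<kappa> B"
  using step
proof cases
  case (Send A \<Phi> x B' ys n zs Cs)
  then have "B \<noteq> B'" using busy_holder_not_dead dead by fastforce
  then show ?thesis using Send(2) by simp
next
  case (SendInfo A \<Phi> y C z B')
  have wf: "wf_config \<kappa>" using inv by (simp add: invariant_def)
  have "Activated (Ref y A C) \<in> \<Phi>"
    using wf_configD(7)[OF wf, of _ _ A] SendInfo(4) known_Some[OF SendInfo(3)] by simp
  then have "B \<noteq> C" using busy_holder_not_dead dead SendInfo(3) by fastforce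
  then show ?thesis using SendInfo(2) by simp
next
  case (SendRelease A \<Phi> x B' n)
  then have "B \<noteq> B'" using busy_holder_not_dead dead by fastforce
  then show ?thesis using SendRelease(2) by simp
next
  case (In A Cs zs)
  have "B \<noteq> A" using dead_not_recept[OF dead] In(3) by auto
  then show ?thesis using In(2) by simp
qed auto

section \<open>Delivery and snapshots along an execution\<close>

text \<open>Collecting the compacted refobs in a set makes the relation transitive, so one instance
  describes any number of compactions. What is known about a refob that \<open>\<Phi>\<close> does
  not record as released stays untouched.\<close>

definition compacted :: "('a, 't) knowledge \<Rightarrow> ('a, 't) knowledge \<Rightarrow> bool" where
  "compacted \<Phi> \<Psi> \<longleftrightarrow> (\<exists>X. (\<forall>r\<in>X. Created r \<in> \<Phi> \<and> Released r \<in> \<Phi>) \<and>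
     \<Psi> = \<Phi> - (\<Union>r\<in>X. {Created r, Released r} \<union> range (RecvCount r)))"

lemma compacted_refl: "compacted \<Phi> \<Phi>"
  unfolding compacted_def by (rule exI[of _ "{}"]) simp

lemma compacted_trans:
  assumes "compacted \<Phi> \<Psi>" and "compacted \<Psi> \<Theta>"
  shows "compacted \<Phi> \<Theta>"
proof -
  obtain X Y where X: "\<forall>r\<in>X. Created r \<in> \<Phi> \<and> Released r \<in> \<Phi>"
      "\<Psi> = \<Phi> - (\<Union>r\<in>X. {Created r, Released r} \<union> range (RecvCount r))"
    and Y: "\<forall>r\<in>Y. Created r \<in> \<Psi> \<and> Released r \<in> \<Psi>"
      "\<Theta> = \<Psi> - (\<Union>r\<in>Y. {Created r, Released r} \<union> range (RecvCount r))"
    using assms unfolding compacted_def by blast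
  have "\<forall>r\<in>X \<union> Y. Created r \<in> \<Phi> \<and> Released r \<in> \<Phi>" using X Y(1) by auto
  moreover have "\<Theta> = \<Phi> - (\<Union>r\<in>X \<union> Y. {Created r, Released r} \<union> range (RecvCount r))"
    unfolding Y(2) X(2) by blast
  ultimately show ?thesis unfolding compacted_def by blast
qed

lemma compacted_iff:
  assumes "compacted \<Phi> \<Psi>"
  shows "CreatedUsing y z \<in> \<Psi> \<longleftrightarrow> CreatedUsing y z \<in> \<Phi>"
    and "Activated r \<in> \<Psi> \<longleftrightarrow> Activated r \<in> \<Phi>"
    and "SentCount r n \<in> \<Psi> \<longleftrightarrow> SentCount r n \<in> \<Phi>"
    and "Released r \<notin> \<Phi> \<Longrightarrow> Released r \<notin> \<Psi>"
    and "Released r \<notin> \<Phi> \<Longrightarrow> Created r \<in> \<Psi> \<longleftrightarrow> Created r \<in> \<Phi>"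
    and "Released r \<notin> \<Phi> \<Longrightarrow> RecvCount r n \<in> \<Psi> \<longleftrightarrow> RecvCount r n \<in> \<Phi>"
  using assms unfolding compacted_def by auto

text \<open>Apart from \<open>Compaction\<close>, an actor that is idle after a step has changed
  only by \<open>Idle\<close>, \<open>Info\<close> or \<open>Release\<close>, which are the events
  that make a snapshot due; spawned actors start out busy.\<close>

lemma idle_before_step:
  assumes "step \<kappa> e \<kappa>'" and "actors \<kappa>' B = Some (idle, \<Psi>)" and "snapshot_due e \<noteq> Some B"
  shows "\<exists>\<Phi>. actors \<kappa> B = Some (idle, \<Phi>) \<and> compacted \<Phi> \<Psi>"
  using assms(1)
proof cases
  case (Compaction C \<Phi> x D)
  have "compacted \<Phi> (\<Phi> - ({Created (Ref x D C), Released (Ref x D C)} \<union> range (RecvCount (Ref x D C))))"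
    unfolding compacted_def using Compaction(4,5) by (intro exI[of _ "{Ref x D C}"]) simp
  then show ?thesis
    using Compaction(2,3) assms(2) compacted_refl by (auto split: if_splits)
qed (use assms(2,3) compacted_refl in \<open>auto split: if_splits\<close>)

text \<open>A dead actor with an empty inbox satisfies neither alternative, so no further snapshot
  becomes due for it.\<close>

lemma snapshot_due_step:
  assumes "step \<kappa> e \<kappa>'" and "snapshot_due e = Some B"
  shows "(\<exists>\<Phi>. actors \<kappa> B = Some (busy, \<Phi>)) \<or> msgs \<kappa> B \<noteq> {#}"
  using assms(1) by cases (use assms(2) in auto)

lemma delivered_step:
  assumes "step \<kappa> e \<kappa>'" and "delivered e = Some (B, m)"
  shows "m \<in># msgs \<kappa> B \<and> msgs \<kappa>' B = msgs \<kappa> B - {#m#}"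
  using assms(1) by cases (use assms(2) in auto)

text \<open>Once all counted messages to a dead actor are delivered, its receive counts have reached
  the counts stated in the pending release messages.\<close>

lemma dead_deliverable:
  assumes inv: "invariant \<kappa>" and dead: "dead \<kappa> B" and m: "m \<in># msgs \<kappa> B"
    and last: "\<And>r n. m = release r n \<Longrightarrow> \<forall>y z D. info y z D \<notin># msgs \<kappa> B"
  shows "deliverable \<kappa> B m"
proof -
  have wf: "wf_config \<kappa>" and bal: "balanced \<kappa>" using inv by (auto simp: invariant_def)
  obtain \<Phi> where idle: "actors \<kappa> B = Some (idle, \<Phi>)" using dead by (rule dead_idle)
  show ?thesis
  proof (cases m)
    case (app r R)
    then show ?thesis using dead_no_app[OF dead] m by blast
  next
    case (info y z D)
    then obtain a b A where "y = Ref a A B" "z = Ref b D B"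
      using wf_configD(5)[OF wf m] by auto
    then show ?thesis
      using step.Info[OF idle, of a A b D] m info unfolding deliverable_def
      by (intro exI[of _ "Info a b A D B"]) auto
  next
    case (release r n)
    then obtain x D where r: "r = Ref x D B" using wf_configD(5)[OF wf m] by auto
    have "\<not> sent_along r m'" if "m' \<in># msgs \<kappa> B" for m'
      using that dead_no_app[OF dead] last[OF release] by (cases m') auto
    then have "cnt (sent_along r) (msgs \<kappa> B) = 0" by (simp add: cnt_eq_0_iff)
    moreover have "n = arrivals \<kappa> r"
      using bal m dead unfolding release r balanced_def dead_def by simp
    ultimately have "n = recv \<Phi> r"
      by (simp add: arrivals_def r known_Some[OF idle])
    then have "\<Phi> \<turnstile> RecvCount r n"
      using recv_iff wf_configD(6)[OF wf, of B] known_Some[OF idle] by metis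
    then show ?thesis
      using step.Release[OF idle, of x D n] m release r unfolding deliverable_def
      by (intro exI[of _ "Release x D B n"]) auto
  qed
qed

section \<open>Dead actors in a fixed execution\<close>

context
  fixes L :: enat and \<kappa> :: "nat \<Rightarrow> ('a, 't) config" and e :: "nat \<Rightarrow> ('a, 't) event"
  assumes execution: "execution L \<kappa> e"
begin

lemma execution_step: "enat i < L \<Longrightarrow> step (\<kappa> i) (e i) (\<kappa> (Suc i))"
  using execution by (simp add: execution_def)

lemma execution_reachable:
  assumes "i \<le> j" and "enat j \<le> L"
  shows "reachable (\<kappa> i) (\<kappa> j)"
  using assms
proof (induction j rule: dec_induct)
  case base
  then show ?case by (simp add: reachable_refl)
next
  case (step j)
  then have "enat j < L" by (simp add: Suc_ile_eq)
  then show ?case using step reachable_snoc execution_step by (meson less_imp_le)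
qed

lemma execution_invariant: "enat i \<le> L \<Longrightarrow> invariant (\<kappa> i)"
  using invariant_reachable[OF execution_reachable[of 0 i] invariant_initial] execution
  by (simp add: execution_def)

lemma execution_dead: "dead (\<kappa> i) B \<Longrightarrow> i \<le> j \<Longrightarrow> enat j \<le> L \<Longrightarrow> dead (\<kappa> j) B"
  by (rule dead_reachable[OF execution_reachable])

lemma execution_dead_msgs:
  assumes "dead (\<kappa> i) B" and "i \<le> j" and "enat j \<le> L"
  shows "msgs (\<kappa> j) B \<subseteq># msgs (\<kappa> i) B"
  using assms(2,3)
proof (induction j rule: dec_induct)
  case (step j)
  then have j: "enat j < L" by (simp add: Suc_ile_eq)
  have "msgs (\<kappa> (Suc j)) B \<subseteq># msgs (\<kappa> j) B"
    using dead_msgs_step[OF execution_invariant execution_step[OF j]] j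
      execution_dead[OF assms(1) step(1)] by simp
  then show ?case using step j by (meson less_imp_le subset_mset.order_trans)
qed simp

lemma execution_holder_of_dead:
  assumes "dead (\<kappa> i) B" and "i \<le> j" and "enat j \<le> L" and "Activated (Ref x D B) \<in> known (\<kappa> j) D"
  shows "Activated (Ref x D B) \<in> known (\<kappa> i) D"
  using assms(2-)
proof (induction j rule: dec_induct)
  case (step j)
  then have j: "enat j < L" by (simp add: Suc_ile_eq)
  have "Activated (Ref x D B) \<in> known (\<kappa> j) D"
    using holder_of_dead_step[OF execution_invariant execution_step[OF j]] j step(5)
      execution_dead[OF assms(1) step(1)] by simp
  then show ?case using step j by simp
qed

text \<open>It serves twice: from time 0 it shows that a snapshot was due at some point, and from
  the time of the last snapshot it limits later changes of knowledge to compaction.\<close>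

lemma execution_idle_before:
  assumes "i \<le> k" and "enat k \<le> L" and "actors (\<kappa> k) B = Some (idle, \<Psi>)"
    and "\<And>l. i \<le> l \<Longrightarrow> l < k \<Longrightarrow> snapshot_due (e l) \<noteq> Some B"
  shows "\<exists>\<Phi>. actors (\<kappa> i) B = Some (idle, \<Phi>) \<and> compacted \<Phi> \<Psi>"
  using assms
proof (induction k arbitrary: \<Psi> rule: dec_induct)
  case base
  then show ?case using compacted_refl by blast
next
  case (step k)
  then have k: "enat k < L" by (simp add: Suc_ile_eq)
  obtain \<Theta> where \<Theta>: "actors (\<kappa> k) B = Some (idle, \<Theta>)" "compacted \<Theta> \<Psi>"
    using idle_before_step[OF execution_step[OF k] step(5)] step(1) step(6)[of k] by auto
  obtain \<Phi> where "actors (\<kappa> i) B = Some (idle, \<Phi>)" "compacted \<Phi> \<Theta>"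
    using step(3)[OF _ \<Theta>(1)] k step(6) by fastforce
  then show ?case using \<Theta>(2) compacted_trans by blast
qed

text \<open>At a time when the inbox has minimal size it can never change again, as it only shrinks.
  A deliverable message left in it would stay deliverable and, by fairness, be delivered, which
  contradicts minimality.\<close>

lemma dead_eventually_no_msgs:
  assumes delivery: "fair_delivery L \<kappa> e" and t: "enat t \<le> L" and dead: "dead (\<kappa> t) B"
  shows "\<exists>j\<ge>t. enat j \<le> L \<and> msgs (\<kappa> j) B = {#}"
proof -
  obtain i where i: "t \<le> i" "enat i \<le> L"
    and min: "\<And>j. t \<le> j \<Longrightarrow> enat j \<le> L \<Longrightarrow> size (msgs (\<kappa> i) B) \<le> size (msgs (\<kappa> j) B)"
    using ex_has_least_nat[of "\<lambda>j. t \<le> j \<and> enat j \<le> L" t "\<lambda>j. size (msgs (\<kappa> j) B)"] t by auto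
  have dead_i: "dead (\<kappa> i) B" using execution_dead[OF dead i] .
  have "msgs (\<kappa> i) B = {#}"
  proof (rule ccontr)
    assume "msgs (\<kappa> i) B \<noteq> {#}"
    then obtain m0 where m0: "m0 \<in># msgs (\<kappa> i) B" by blast
    \<comment> \<open>An \<open>info\<close> message is preferred: the count of a release message is
      known to be reached only when no \<open>info\<close> message is left.\<close>
    obtain m where m: "m \<in># msgs (\<kappa> i) B"
      and last: "\<And>r n. m = release r n \<Longrightarrow> \<forall>y z D. info y z D \<notin># msgs (\<kappa> i) B"
      using m0 by (cases "\<exists>y z D. info y z D \<in># msgs (\<kappa> i) B") auto
    obtain j where j: "i \<le> j"
      and cases: "(enat j < L \<and> delivered (e j) = Some (B, m)) \<or>
        (enat j \<le> L \<and> \<not> deliverable (\<kappa> j) B m)"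
      using delivery i(2) m unfolding fair_delivery_def by blast
    have jL: "enat j \<le> L" using cases by auto
    have "msgs (\<kappa> j) B \<subseteq># msgs (\<kappa> i) B" using execution_dead_msgs[OF dead_i j jL] .
    moreover have "size (msgs (\<kappa> i) B) \<le> size (msgs (\<kappa> j) B)" using min[of j] i(1) j jL by simp
    ultimately have same: "msgs (\<kappa> j) B = msgs (\<kappa> i) B"
      by (metis leD mset_subset_size subset_mset.le_imp_less_or_eq)
    \<comment> \<open>Deliverability is needed at time \<open>j\<close> itself, in order to exclude
      the second alternative of fairness.\<close>
    have "deliverable (\<kappa> j) B m"
      using dead_deliverable[OF execution_invariant[OF jL] execution_dead[OF dead_i j jL]] m last same
      by simp
    then have d: "enat j < L" "delivered (e j) = Some (B, m)" using cases by auto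
    have "msgs (\<kappa> (Suc j)) B = msgs (\<kappa> i) B - {#m#}"
      using delivered_step[OF execution_step[OF d(1)] d(2)] same by simp
    then have "size (msgs (\<kappa> (Suc j)) B) < size (msgs (\<kappa> i) B)"
      using m by (simp add: size_Diff1_less)
    moreover have "enat (Suc j) \<le> L" using d(1) by (simp add: Suc_ile_eq)
    ultimately show False using min[of "Suc j"] i(1) j by simp
  qed
  then show ?thesis using i by blast
qed

text \<open>The snapshot is one taken after the last event that made it due. Its time
  \<open>i\<close> may lie before \<open>t\<close>; only \<open>j\<close>, from which on it can be
  relied upon, is bounded below by \<open>t\<close>.\<close>

lemma dead_eventually_snapshot:
  assumes delivery: "fair_delivery L \<kappa> e" and snapshots: "eventual_snapshots L e"
    and t: "enat t \<le> L" and dead: "dead (\<kappa> t) B"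
  shows "\<exists>j i \<Phi>. t \<le> j \<and> enat j \<le> L \<and> i < j \<and> e i = Snapshot B \<Phi> \<and> \<Phi> = known (\<kappa> i) B \<and>
    (\<forall>k\<ge>j. enat k \<le> L \<longrightarrow> msgs (\<kappa> k) B = {#} \<and> compacted \<Phi> (known (\<kappa> k) B))"
proof -
  obtain j0 where j0: "t \<le> j0" "enat j0 \<le> L" "msgs (\<kappa> j0) B = {#}"
    using dead_eventually_no_msgs[OF delivery t dead] by blast
  have dead0: "dead (\<kappa> j0) B" using execution_dead[OF dead j0(1,2)] .
  have empty: "msgs (\<kappa> k) B = {#}" if "j0 \<le> k" "enat k \<le> L" for k
    using execution_dead_msgs[OF dead0 that] j0(3) by simp
  have later: "snapshot_due (e k) \<noteq> Some B" if "j0 \<le> k" "enat k < L" for k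
    using snapshot_due_step[OF execution_step[OF that(2)]] empty[of k] that
      dead_idle[OF execution_dead[OF dead0, of k]] by fastforce
  let ?due = "{l. l < j0 \<and> snapshot_due (e l) = Some B}"
  \<comment> \<open>Otherwise the actor would have been idle from the beginning, but the only actor
    of the initial configuration is busy.\<close>
  have "?due \<noteq> {}"
  proof
    assume none: "?due = {}"
    obtain \<Psi> where "actors (\<kappa> j0) B = Some (idle, \<Psi>)" using dead0 by (rule dead_idle)
    then obtain \<Phi> where "actors (\<kappa> 0) B = Some (idle, \<Phi>)"
      using execution_idle_before[of 0 j0 B \<Psi>] none j0(2) by blast
    then show False
      using execution by (auto simp: execution_def initial_def split: if_splits)
  qed
  moreover have fin: "finite ?due" by simp
  ultimately have "Max ?due \<in> ?due" by (rule Max_in[rotated])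
  then have l: "Max ?due < j0" "snapshot_due (e (Max ?due)) = Some B" by auto
  then obtain i \<Phi> where i: "Max ?due < i" "enat i < L" "e i = Snapshot B \<Phi>"
    using snapshots j0(2) unfolding eventual_snapshots_def
    by (meson enat_ord_simps(2) order_less_le_trans)
  have \<Phi>: "actors (\<kappa> i) B = Some (idle, \<Phi>)"
    using execution_step[OF i(2)] unfolding i(3) by cases auto
  \<comment> \<open>Before \<open>j0\<close> such an event would exceed the maximum of
    \<open>?due\<close>, and from \<open>j0\<close> on there is none.\<close>
  have none: "snapshot_due (e l) \<noteq> Some B" if "i \<le> l" "enat l < L" for l
  proof
    assume *: "snapshot_due (e l) = Some B"
    then have "l < j0" using later that(2) by (meson not_less)
    then have "l \<le> Max ?due" using * fin by (intro Max_ge) auto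
    then show False using i(1) that(1) by simp
  qed
  \<comment> \<open>The snapshot may come before or after the inbox has become empty; the time
    chosen has to lie after both.\<close>
  let ?j = "max j0 (Suc i)"
  have "compacted \<Phi> (known (\<kappa> k) B)" if k: "?j \<le> k" "enat k \<le> L" for k
  proof -
    obtain \<Psi> where \<Psi>: "actors (\<kappa> k) B = Some (idle, \<Psi>)"
      using dead_idle[OF execution_dead[OF dead0 _ k(2)]] k(1) by auto
    have "enat l < L" if "l < k" for l
      using that k(2) by (meson enat_ord_simps(2) order_less_le_trans)
    then have "\<exists>\<Phi>. actors (\<kappa> i) B = Some (idle, \<Phi>) \<and> compacted \<Phi> \<Psi>"
      using none k by (intro execution_idle_before[OF _ k(2) \<Psi>]) auto
    then show ?thesis using \<Phi> known_Some[OF \<Psi>] by simp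
  qed
  moreover have "enat ?j \<le> L" using j0(2) i(2) by (simp add: max_def Suc_ile_eq)
  moreover have "t \<le> ?j" "i < ?j" using j0(1) by auto
  ultimately show ?thesis
    using empty i(3) known_Some[OF \<Phi>] by (intro exI[of _ ?j] exI[of _ i] exI[of _ \<Phi>]) auto
qed

end

section \<open>The finalized set of snapshots\<close>

theorem mainTheorem5:
  fixes L :: enat
    and \<kappa> :: "nat \<Rightarrow> ('a, 't) config"
    and e :: "nat \<Rightarrow> ('a, 't) event"
  assumes execution: "execution L \<kappa> e"
    and delivery: "fair_delivery L \<kappa> e"
    and snapshots: "eventual_snapshots L e"
    and time: "enat t \<le> L"
    and terminated: "terminated (\<kappa> t) A"
  shows "\<exists>j Q. t \<le> j \<and> enat j \<le> L \<and> snapshots_taken_by e j Q \<and> finalized Q \<and> A \<in> dom Q"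
proof -
  define S where "S = {B. dead (\<kappa> t) B}"
  have A: "A \<in> S" using terminated_dead[OF terminated] by (simp add: S_def)
  have "wf_config (\<kappa> t)" using execution_invariant[OF execution time] by (simp add: invariant_def)
  then have fin: "finite S"
    by (rule finite_subset[OF _ wf_configD(1), rotated]) (auto simp: S_def dead_def)
  define final where "final B j i \<Phi> \<longleftrightarrow> t \<le> j \<and> enat j \<le> L \<and> i < j \<and> e i = Snapshot B \<Phi> \<and>
      \<Phi> = known (\<kappa> i) B \<and>
      (\<forall>k\<ge>j. enat k \<le> L \<longrightarrow> msgs (\<kappa> k) B = {#} \<and> compacted \<Phi> (known (\<kappa> k) B))" for B j i \<Phi>
  have "\<exists>j i \<Phi>. final B j i \<Phi>" if "B \<in> S" for B
    using dead_eventually_snapshot[OF execution delivery snapshots time, of B] that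
    by (simp add: S_def final_def)
  then obtain j i \<Phi> where "\<And>B. B \<in> S \<Longrightarrow> final B (j B) (i B) (\<Phi> B)"
    by metis
  note j = this[unfolded final_def]
  \<comment> \<open>The common time of comparison: here all inboxes of \<open>S\<close> are empty,
    all snapshots are taken, and current knowledge differs from them by compaction only.\<close>
  define J where "J = Max (j ` S)"
  have "J \<in> j ` S" unfolding J_def using fin A by (intro Max_in) auto
  then have J: "t \<le> J" "enat J \<le> L" using j by auto
  have jJ: "j B \<le> J" if "B \<in> S" for B unfolding J_def using fin that by simp
  have empty: "msgs (\<kappa> J) B = {#}" and comp: "compacted (\<Phi> B) (known (\<kappa> J) B)" if "B \<in> S" for B
    using j[OF that] jJ[OF that] J(2) by auto
  \<comment> \<open>A snapshot is the knowledge of its actor at time \<open>i B\<close>, so the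
    invariants of that configuration apply to it.\<close>
  have wf_i: "wf_config (\<kappa> (i B))" if "B \<in> S" for B
  proof -
    have "enat (i B) \<le> L" using j[OF that] by (meson enat_ord_simps(1) less_imp_le order_trans)
    then show ?thesis using execution_invariant[OF execution] by (simp add: invariant_def)
  qed
  have sv: "single_valued_counts (\<Phi> B)" if "B \<in> S" for B
    using wf_configD(6)[OF wf_i[OF that]] j[OF that] by metis
  have inv: "invariant (\<kappa> J)" using execution_invariant[OF execution J(2)] .
  have deadJ: "dead (\<kappa> J) B" if "B \<in> S" for B
    using execution_dead[OF execution _ J] that by (simp add: S_def)
  define Q where "Q = (\<lambda>B. if B \<in> S then Some (\<Phi> B) else None)"
  have domQ: "dom Q = S" by (auto simp: Q_def split: if_splits)
  have ranQ: "ran Q = \<Phi> ` S" by (auto simp: Q_def ran_def)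
  have key: "D \<in> S \<and> Activated (Ref x D B) \<in> \<Phi> D \<and> sent (\<Phi> D) (Ref x D B) = recv (\<Phi> B) (Ref x D B)"
    if B: "B \<in> S" and un: "Q \<Turnstile> Unreleased (Ref x D B)" for x D B
  proof -
    let ?r = "Ref x D B"
    \<comment> \<open>This relies on reading \<open>Unreleased\<close> against all of
      \<open>Q\<close>, to which the snapshot of the target \<open>B\<close> belongs. It protects
      what \<open>B\<close> knows about the refob from compaction.\<close>
    have rel: "Released ?r \<notin> \<Phi> B"
      using un B unfolding Q_derives_def ranQ by auto
    obtain C where C: "C \<in> S" "\<Phi> C \<turnstile> Unreleased ?r"
      using un unfolding Q_derives_def ranQ by blast
    have kC: "known (\<kappa> (i C)) C = \<Phi> C" using j[OF C(1)] by simp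
    note wfC = wf_configD(4)[OF wf_i[OF C(1)], of _ C, unfolded kC]
    have "Unreleased ?r \<notin> \<Phi> C" using wfC[of "Unreleased ?r"] by auto
    then consider "Created ?r \<in> \<Phi> C" | y where "CreatedUsing y ?r \<in> \<Phi> C"
      using C(2) unfolding derives_Unreleased_iff derives_Created_iff by blast
    then have "announced (\<kappa> J) ?r \<noteq> 0"
    proof cases
      case 1
      \<comment> \<open>By well-formedness a \<open>Created\<close> fact is held by the target of
        the refob, whereas a \<open>CreatedUsing\<close> fact may come from any actor in
        \<open>S\<close>.\<close>
      then have "C = B" using wfC[OF 1] by simp
      then have "Created ?r \<in> known (\<kappa> J) B" using 1 compacted_iff(5)[OF comp[OF B] rel] by simp
      then show ?thesis by (simp add: announced_def)
    next
      case 2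
      then have "CreatedUsing y ?r \<in> known (\<kappa> J) C" using compacted_iff(1)[OF comp[OF C(1)]] by simp
      then show ?thesis by (auto simp: announced_def)
    qed
    moreover have domB: "B \<in> dom (actors (\<kappa> J))" and recB: "B \<notin> recept (\<kappa> J)"
      using deadJ[OF B] dead_not_recept[OF deadJ[OF B]] by (simp_all add: dead_def)
    moreover have "announced (\<kappa> J) ?r \<le> stage (\<kappa> J) ?r"
      using inv domB recB unfolding invariant_def life_cycle_def by blast
    ultimately have "stage (\<kappa> J) ?r \<noteq> 0" by linarith
    \<comment> \<open>From here three stages are ruled out: carried, because \<open>B\<close> is
      dead; release under way, because the inbox of \<open>B\<close> is empty; released, because
      compaction adds no facts to the snapshot of \<open>B\<close>.\<close>
    moreover have "cnt (carries ?r) (msgs (\<kappa> J) D) = 0"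
    proof -
      have "\<not> carries ?r m" if "m \<in># msgs (\<kappa> J) D" for m
        using that dead_not_pending[OF inv deadJ[OF B]] by (cases m) auto
      then show ?thesis by (simp add: cnt_eq_0_iff)
    qed
    moreover have "Released ?r \<notin> known (\<kappa> J) B" using compacted_iff(4)[OF comp[OF B] rel] .
    ultimately have act: "Activated ?r \<in> known (\<kappa> J) D"
      using empty[OF B] by (simp add: stage_def split: if_splits)
    \<comment> \<open>Deadness of the owner at \<open>J\<close> would not suffice, since
      \<open>S\<close> was fixed at \<open>t\<close>; so its hold on the refob is traced back to
      that time.\<close>
    then have "dead (\<kappa> t) D"
      using holder_of_dead execution_holder_of_dead[OF execution _ J act] B by (auto simp: S_def)
    then have D: "D \<in> S" by (simp add: S_def)
    have "sent (known (\<kappa> J) D) ?r = arrivals (\<kappa> J) ?r"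
      using inv domB act unfolding invariant_def balanced_def by blast
    also have "\<dots> = recv (known (\<kappa> J) B) ?r" using empty[OF B] by (simp add: arrivals_def)
    \<comment> \<open>Compaction deletes receive counts of released refobs only, and the snapshot of
      \<open>B\<close> does not record this one as released.\<close>
    also have "\<dots> = recv (\<Phi> B) ?r"
      by (intro recv_cong compacted_iff(6)[OF comp[OF B] rel])
    also have "sent (known (\<kappa> J) D) ?r = sent (\<Phi> D) ?r"
      by (intro sent_cong compacted_iff(3)[OF comp[OF D]])
    finally show ?thesis using D act compacted_iff(2)[OF comp[OF D]] by simp
  qed
  have "snapshots_taken_by e J Q"
    unfolding snapshots_taken_by_def
  proof (intro allI impI)
    fix B \<Psi>
    assume "Q B = Some \<Psi>"
    then have "B \<in> S" "\<Psi> = \<Phi> B" by (auto simp: Q_def split: if_splits)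
    then have "i B < J" "e (i B) = Snapshot B \<Psi>" using j[of B] jJ[of B] by auto
    then show "\<exists>i<J. e i = Snapshot B \<Psi>" by blast
  qed
  moreover have "finalized Q"
    unfolding finalized_def closed_snapshots_def appears_blocked_def domQ
  proof (intro conjI allI impI ballI)
    fix x D B
    assume "Q \<Turnstile> Unreleased (Ref x D B) \<and> B \<in> S"
    then show "\<exists>\<Phi>A. Q D = Some \<Phi>A \<and> \<Phi>A \<turnstile> Activated (Ref x D B)"
      using key[of B x D] by (simp add: Q_def)
  next
    fix B x D
    assume B: "B \<in> S" and un: "Q \<Turnstile> Unreleased (Ref x D B)"
    note k = key[OF B un]
    have "\<Phi> D \<turnstile> SentCount (Ref x D B) (sent (\<Phi> D) (Ref x D B))"
      "\<Phi> B \<turnstile> RecvCount (Ref x D B) (sent (\<Phi> D) (Ref x D B))"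
      using k sent_iff[OF sv[of D]] recv_iff[OF sv[OF B]] by simp_all
    then show "\<exists>\<Phi>A \<Phi>B n. Q D = Some \<Phi>A \<and> Q B = Some \<Phi>B \<and>
        \<Phi>A \<turnstile> SentCount (Ref x D B) n \<and> \<Phi>B \<turnstile> RecvCount (Ref x D B) n"
      using k B by (auto simp: Q_def)
  qed
  moreover have "A \<in> dom Q" using A domQ by simp
  ultimately show ?thesis using J by blast
qed

end
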